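(* Let $(\theta_i)_{i\ge 1}$ and $(\kappa_{i,j})_{i,j\ge 1}$ be sequences of non-negative real numbers such that the coagulation kernel satisfies $\Lambda_{i,j}=\theta_i\theta_j+\kappa_{i,j}$ for all $i,j\ge 1$. Assume that either (a) $\lim_{i\to\infty}\frac{\theta_i}{i}=0$ and, for each $i\ge 1$, $\lim_{j\to\infty}\frac{\kappa_{i,j}}{j}=0$; or (b) $\inf_{i\ge 1}\frac{\theta_i}{i}=B>0$ and there is $A\ge 0$ such that $\kappa_{i,j}\le A\theta_i\theta_j$ for all $i,j\ge 1$. Then for every $\omega^{in}=(\omega_i^{in})_{i\ge 1}\in Y_1^+$ there exists at least one solution $\omega=(\omega_i)_{i\ge 1}$ on $[0,+\infty)$ to the discrete Safronov-Dubovskii coagulation equations with initial datum $\omega^{in}$, such that $\omega(t)\in Y_1^+$ for each $t\in[0,+\infty)$ and $$\|\omega(t)\|_1\le \|\omega^{in}\|_1 .$$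
   Context: The coagulation kernel $(\Lambda_{i,j})_{i,j\ge1}$ is non-negative and symmetric: $0\le\Lambda_{i,j}=\Lambda_{j,i}$ for all $i,j\ge 1$. The discrete Safronov-Dubovskii coagulation equations with initial datum $\omega^{in}=(\omega_i^{in})_{i\ge1}$, $\omega_i^{in}\ge0$, are, for $i\ge 1$, $$\frac{d\omega_i(t)}{dt}=\omega_{i-1}(t)\sum_{j=1}^{i-1}j\Lambda_{i-1,j}\omega_j(t)-\omega_i(t)\sum_{j=1}^{i}j\Lambda_{i,j}\omega_j(t)-\sum_{j=i}^{\infty}\Lambda_{i,j}\omega_i(t)\omega_j(t),\qquad \omega_i(0)=\omega_i^{in},$$ where the first term on the right-hand side is $0$ when $i=1$. Solution: for $T\in(0,+\infty]$, a solution on $[0,T)$ is a sequence $\omega=(\omega_i)_{i\ge1}$ of non-negative continuous functions on $[0,T)$ such that, for each $i\ge1$ and $t\in(0,T)$: $\omega_i\in\mathcal{C}([0,T))$, $\sum_{j=1}^\infty\Lambda_{i,j}\omega_j\in L^1(0,t)$, and $$\omega_i(t)=\omega_i^{in}+\int_0^t\Big(\omega_{i-1}(s)\sum_{j=1}^{i-1}j\Lambda_{i-1,j}\omega_j(s)-\omega_i(s)\sum_{j=1}^{i}j\Lambda_{i,j}\omega_j(s)-\sum_{j=i}^{\infty}\Lambda_{i,j}\omega_i(s)\omega_j(s)\Big)ds .$$ For $p\ge0$, $Y_p=\{y=(y_i)_{i\ge1}:\ \|y\|_p:=\sum_{i=1}^\infty i^p|y_i|<\infty\}$ (real sequences) and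 $Y_p^+=\{y\in Y_p:\ y_i\ge0 \text{ for each } i\ge1\}$. *)

theory Defs
  imports "HOL-Analysis.Analysis"
begin

text \<open>
  Sequences indexed by $i \ge 1$ are functions on \<^typ>\<open>nat\<close> whose value at \<open>0\<close> is ignored;
  a series over $j \ge i$ is written with the summation index shifted by \<open>i\<close>.
\<close>

definition coag_kernel :: "(nat \<Rightarrow> nat \<Rightarrow> real) \<Rightarrow> bool" where
  "coag_kernel \<Lambda> \<longleftrightarrow> (\<forall>i\<ge>1. \<forall>j\<ge>1. 0 \<le> \<Lambda> i j \<and> \<Lambda> i j = \<Lambda> j i)"

definition Y :: "real \<Rightarrow> (nat \<Rightarrow> real) set" where
  "Y p = {y. summable (\<lambda>i. real (Suc i) powr p * \<bar>y (Suc i)\<bar>)}"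

definition Y_norm :: "real \<Rightarrow> (nat \<Rightarrow> real) \<Rightarrow> real" where
  "Y_norm p y = (\<Sum>i. real (Suc i) powr p * \<bar>y (Suc i)\<bar>)"

definition Y_plus :: "real \<Rightarrow> (nat \<Rightarrow> real) set" where
  "Y_plus p = {y \<in> Y p. \<forall>i\<ge>1. 0 \<le> y i}"

text \<open>For \<open>i = 1\<close> the sum in the first term is empty, so that term vanishes whatever \<open>y 0\<close> is.\<close>

definition sd_rhs :: "(nat \<Rightarrow> nat \<Rightarrow> real) \<Rightarrow> (nat \<Rightarrow> real) \<Rightarrow> nat \<Rightarrow> real" where
  "sd_rhs \<Lambda> y i =
     y (i - 1) * (\<Sum>j = 1..i - 1. real j * \<Lambda> (i - 1) j * y j)
     - y i * (\<Sum>j = 1..i. real j * \<Lambda> i j * y j)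
     - (\<Sum>j. \<Lambda> i (i + j) * y i * y (i + j))"

text \<open>
  A solution on $[0,T)$, where \<open>T\<close> may be \<open>\<infinity>\<close>. Membership of
  $\sum_{j \ge 1} \Lambda_{i,j} \omega_j$ in $L^1(0,t)$ means convergence of the series for almost
  every time together with integrability of its sum; the former has to be required explicitly
  because \<^const>\<open>suminf\<close> is total. Since $\omega_i$ is bounded on $[0,t]$, this makes the
  integrand of the integral equation Lebesgue integrable on $[0,t]$.
\<close>

definition sd_solution ::
  "(nat \<Rightarrow> nat \<Rightarrow> real) \<Rightarrow> (nat \<Rightarrow> real) \<Rightarrow> ereal \<Rightarrow> (nat \<Rightarrow> real \<Rightarrow> real) \<Rightarrow> bool" where
  "sd_solution \<Lambda> \<omega>in T \<omega> \<longleftrightarrow> 0 < T \<and>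
     (\<forall>i\<ge>1.
        continuous_on {t. 0 \<le> t \<and> ereal t < T} (\<omega> i) \<and>
        (\<forall>t. 0 \<le> t \<and> ereal t < T \<longrightarrow> 0 \<le> \<omega> i t) \<and>
        (\<forall>t. 0 < t \<and> ereal t < T \<longrightarrow>
           (AE s in lborel. s \<in> {0<..<t} \<longrightarrow> summable (\<lambda>j. \<Lambda> i (Suc j) * \<omega> (Suc j) s)) \<and>
           set_integrable lborel {0<..<t} (\<lambda>s. \<Sum>j. \<Lambda> i (Suc j) * \<omega> (Suc j) s) \<and>
           \<omega> i t = \<omega>in i + (LBINT s:{0..t}. sd_rhs \<Lambda> (\<lambda>k. \<omega> k s) i)))"

end

theory Submission
  imports Defs "HOL-Complex_Analysis.Great_Picard"
begin

text \<open>
  Solutions are obtained as limits of the explicit Euler scheme for the system truncated at size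
  \<open>n\<close>, with step \<open>h n\<close> tending to \<open>0\<close>. If the step is small
  enough, the scheme keeps all densities non-negative and conserves the mass
  $\sum_i i\,u_i$ exactly (\<open>mass_balance\<close>, \<open>mass_le_euler\<close>), so no existence theory for ordinary
  differential equations enters.

  The key estimate comes from the weak form of the system,
  \[ \frac{d}{dt} \sum_i g_i \omega_i
     = \sum_i \sum_{j \le i} \bigl(j (g_{i+1} - g_i) - g_j\bigr) \Lambda_{i,j} \omega_i \omega_j . \]
  For $g_i = \min(i,r)$ the bracket vanishes if $i < r$ and equals $-\min(j,r)$ if $i \ge r$.
  Keeping only the terms with $r \le j \le i$ and using $\Lambda_{i,j} \ge \theta_i \theta_j$,
  symmetry gives
  \[ \int_0^\infty \Bigl(\sum_{i \ge r} \theta_i \omega_i\Bigr)^2 dt \le \frac{2M}{r}, \]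
  where $M$ is the initial mass. This holds verbatim for the Euler scheme
  (\<open>gel_estimate\<close>), uniformly in \<open>n\<close>.

  Both alternatives (a) and (b) on the kernel imply that for each $i$ there is a constant $C$
  such that, for every $\varepsilon > 0$, the inequality
  $\Lambda_{i,j} \le \varepsilon j + C \theta_j$ holds for all large $j$
  (\<open>tail_growth\<close>). Mass conservation controls the first summand, and the estimate
  above, with the Cauchy-Schwarz inequality in time, controls the second. Hence the time integrals
  of the tails $\sum_{j \ge N} \Lambda_{i,j} \omega_j$ become small as $N$ grows, uniformly in
  \<open>n\<close> (\<open>tail_estimate\<close>). The same bound with $N = 1$ makes each component of
  the scheme equicontinuous up to the mesh size, and a diagonal Arzela-Ascoli argument
  (\<open>asymptotic_ascoli\<close>) yields a subsequence that converges pointwise to continuous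
  limits.

  In the limit, every term of the equation that involves finitely many components passes by
  dominated convergence (\<open>step_sum_tendsto_integral\<close>). Only the infinite loss sum is
  cut off at $N$, at a cost that the tail estimate bounds; letting $N \to \infty$ then gives the
  integral equation (\<open>sd_solution_exists\<close>).
\<close>

section \<open>The truncated system and its explicit Euler scheme\<close>

text \<open>
  The equation of index \<open>i\<close> is driven by the flux from size \<open>i\<close> to size
  \<open>i + 1\<close> and by the destruction of the smaller partner. Both are cut off so that only
  sizes up to \<open>n\<close> interact. As the flux out of size \<open>n\<close> is kept, the
  truncated system reaches size \<open>n + 1\<close>, and it is precisely this choice that makes the
  mass exactly conserved. Components beyond \<open>n + 1\<close> do not move.
\<close>

definition flux :: "(nat \<Rightarrow> nat \<Rightarrow> real) \<Rightarrow> nat \<Rightarrow> (nat \<Rightarrow> real) \<Rightarrow> nat \<Rightarrow> real" where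
  "flux \<Lambda> n u i = (if i \<le> n then u i * (\<Sum>j = 1..i. real j * \<Lambda> i j * u j) else 0)"

definition loss :: "(nat \<Rightarrow> nat \<Rightarrow> real) \<Rightarrow> nat \<Rightarrow> (nat \<Rightarrow> real) \<Rightarrow> nat \<Rightarrow> real" where
  "loss \<Lambda> n u i = u i * (\<Sum>j = i..n. \<Lambda> i j * u j)"

definition trunc_rhs :: "(nat \<Rightarrow> nat \<Rightarrow> real) \<Rightarrow> nat \<Rightarrow> (nat \<Rightarrow> real) \<Rightarrow> nat \<Rightarrow> real" where
  "trunc_rhs \<Lambda> n u i = flux \<Lambda> n u (i - 1) - flux \<Lambda> n u i - loss \<Lambda> n u i"

primrec euler :: "(nat \<Rightarrow> nat \<Rightarrow> real) \<Rightarrow> nat \<Rightarrow> real \<Rightarrow> (nat \<Rightarrow> real) \<Rightarrow> nat \<Rightarrow> nat \<Rightarrow> real" where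
  "euler \<Lambda> n h u 0 = u"
| "euler \<Lambda> n h u (Suc k) = (\<lambda>i. euler \<Lambda> n h u k i + h * trunc_rhs \<Lambda> n (euler \<Lambda> n h u k) i)"

text \<open>
  The invariant region of the scheme, and also the form in which mass bounds pass to pointwise
  limits: it involves finite sums only.
\<close>

definition mass_le :: "real \<Rightarrow> (nat \<Rightarrow> real) \<Rightarrow> bool" where
  "mass_le M u \<longleftrightarrow> (\<forall>i\<ge>1. 0 \<le> u i) \<and> (\<forall>N. (\<Sum>i = 1..N. real i * u i) \<le> M)"

lemma mass_le_sum: "mass_le M u \<Longrightarrow> (\<Sum>i = 1..N. real i * u i) \<le> M"
  by (simp add: mass_le_def)

lemma mass_le_sum_subset:
  assumes "mass_le M u" "finite S" "0 \<notin> S"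
  shows "(\<Sum>i\<in>S. real i * u i) \<le> M"
proof -
  have "S \<subseteq> {1..Max (insert 0 S)}"
    using assms by (auto simp: Suc_le_eq intro: gr0I)
  then have "(\<Sum>i\<in>S. real i * u i) \<le> (\<Sum>i = 1..Max (insert 0 S). real i * u i)"
    using assms by (intro sum_mono2) (auto simp: mass_le_def)
  also have "\<dots> \<le> M"
    using assms by (intro mass_le_sum)
  finally show ?thesis .
qed

lemma mass_le_nonneg: "mass_le M u \<Longrightarrow> 1 \<le> i \<Longrightarrow> 0 \<le> u i"
  by (simp add: mass_le_def)

lemma mass_le_component:
  assumes "mass_le M u" "1 \<le> i"
  shows "u i \<le> M"
proof -
  have "u i \<le> real i * u i"
    using assms mult_right_mono[of 1 "real i" "u i"] by (simp add: mass_le_nonneg)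
  also have "\<dots> \<le> M"
    using mass_le_sum_subset[OF assms(1), of "{i}"] assms by simp
  finally show ?thesis .
qed

lemma sum_flux_by_parts:
  fixes g :: "nat \<Rightarrow> real"
  shows "(\<Sum>i = 1..N. g i * (flux \<Lambda> n u (i - 1) - flux \<Lambda> n u i))
    = (\<Sum>i = 1..N. (g (Suc i) - g i) * flux \<Lambda> n u i) - g (Suc N) * flux \<Lambda> n u N"
proof (induction N)
  case 0
  show ?case by (simp add: flux_def)
next
  case (Suc N)
  then show ?case by (simp add: algebra_simps)
qed

lemma sum_triangle_swap:
  fixes f :: "nat \<Rightarrow> nat \<Rightarrow> 'a::comm_monoid_add"
  shows "(\<Sum>i = m..n. \<Sum>j = i..n. f i j) = (\<Sum>i = m..n. \<Sum>j = m..i. f j i)"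
proof -
  have "(\<Sum>i = m..n. \<Sum>j = i..n. f i j) = (\<Sum>i = m..n. \<Sum>j\<in>{j \<in> {m..n}. i \<le> j}. f i j)"
    by (intro sum.cong) auto
  also have "\<dots> = (\<Sum>j = m..n. \<Sum>i\<in>{i \<in> {m..n}. i \<le> j}. f i j)"
    by (rule sum.swap_restrict) auto
  also have "\<dots> = (\<Sum>j = m..n. \<Sum>i = m..j. f i j)"
    by (intro sum.cong) auto
  finally show ?thesis .
qed

lemma square_sum_le_triangle:
  fixes x :: "nat \<Rightarrow> real"
  assumes "\<And>i. i \<in> {m..n} \<Longrightarrow> 0 \<le> x i"
  shows "(\<Sum>i = m..n. x i)\<^sup>2 \<le> 2 * (\<Sum>i = m..n. \<Sum>j = m..i. x i * x j)"
proof -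
  have "(\<Sum>i = m..n. x i)\<^sup>2 = (\<Sum>i = m..n. \<Sum>j = m..n. x i * x j)"
    by (simp add: power2_eq_square sum_product)
  also have "\<dots> \<le> (\<Sum>i = m..n. (\<Sum>j = m..i. x i * x j) + (\<Sum>j = i..n. x i * x j))"
  proof (rule sum_mono)
    fix i assume i: "i \<in> {m..n}"
    have "(\<Sum>j = m..n. x i * x j) = (\<Sum>j = m..i. x i * x j) + (\<Sum>j = Suc i..n. x i * x j)"
      using i by (subst sum.union_disjoint[symmetric]) (auto intro!: sum.cong)
    also have "(\<Sum>j = Suc i..n. x i * x j) \<le> (\<Sum>j = i..n. x i * x j)"
      using i assms by (intro sum_mono2) auto
    finally show "(\<Sum>j = m..n. x i * x j) \<le> (\<Sum>j = m..i. x i * x j) + (\<Sum>j = i..n. x i * x j)"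
      by simp
  qed
  also have "\<dots> = 2 * (\<Sum>i = m..n. \<Sum>j = m..i. x i * x j)"
    using sum_triangle_swap[of "\<lambda>i j. x i * x j" n m] by (simp add: sum.distrib mult.commute)
  finally show ?thesis .
qed

text \<open>
  The product $\theta_i \theta_j$ enters as a lower bound of the kernel; it is the source of
  the dissipation.
\<close>

locale sd_kernel =
  fixes \<Lambda> :: "nat \<Rightarrow> nat \<Rightarrow> real" and \<theta> :: "nat \<Rightarrow> real"
  assumes sym: "1 \<le> i \<Longrightarrow> 1 \<le> j \<Longrightarrow> \<Lambda> i j = \<Lambda> j i"
    and theta_nonneg: "1 \<le> i \<Longrightarrow> 0 \<le> \<theta> i"
    and theta_prod_le: "1 \<le> i \<Longrightarrow> 1 \<le> j \<Longrightarrow> \<theta> i * \<theta> j \<le> \<Lambda> i j"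
begin

lemma kernel_nonneg: "1 \<le> i \<Longrightarrow> 1 \<le> j \<Longrightarrow> 0 \<le> \<Lambda> i j"
  using theta_nonneg[of i] theta_nonneg[of j] theta_prod_le[of i j]
  by (meson mult_nonneg_nonneg order_trans)

text \<open>
  Summation by parts moves the differences of the fluxes onto \<open>g\<close>; exchanging the roles
  of \<open>i\<close> and \<open>j\<close> in the loss term, by symmetry of the kernel, brings both
  contributions to the triangle $j \le i$.
\<close>

lemma weak_form:
  fixes g :: "nat \<Rightarrow> real"
  assumes "n < N"
  shows "(\<Sum>i = 1..N. g i * trunc_rhs \<Lambda> n u i)
    = (\<Sum>i = 1..n. \<Sum>j = 1..i. (real j * (g (Suc i) - g i) - g j) * (\<Lambda> i j * u i * u j))"
proof -
  have "(\<Sum>i = 1..N. (g (Suc i) - g i) * flux \<Lambda> n u i)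
      = (\<Sum>i = 1..n. (g (Suc i) - g i) * flux \<Lambda> n u i)"
    using assms by (intro sum.mono_neutral_right) (auto simp: flux_def)
  also have "\<dots> = (\<Sum>i = 1..n. \<Sum>j = 1..i. real j * (g (Suc i) - g i) * (\<Lambda> i j * u i * u j))"
    by (intro sum.cong) (auto simp: flux_def sum_distrib_left algebra_simps)
  finally have *: "(\<Sum>i = 1..N. g i * (flux \<Lambda> n u (i - 1) - flux \<Lambda> n u i))
      = (\<Sum>i = 1..n. \<Sum>j = 1..i. real j * (g (Suc i) - g i) * (\<Lambda> i j * u i * u j))"
    using assms unfolding sum_flux_by_parts by (simp add: flux_def)
  have "(\<Sum>i = 1..N. g i * loss \<Lambda> n u i) = (\<Sum>i = 1..n. g i * loss \<Lambda> n u i)"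
    using assms by (intro sum.mono_neutral_right) (auto simp: loss_def)
  also have "\<dots> = (\<Sum>i = 1..n. \<Sum>j = i..n. g i * (\<Lambda> i j * u i * u j))"
    by (simp add: loss_def sum_distrib_left algebra_simps)
  also have "\<dots> = (\<Sum>i = 1..n. \<Sum>j = 1..i. g j * (\<Lambda> j i * u j * u i))"
    by (rule sum_triangle_swap)
  also have "\<dots> = (\<Sum>i = 1..n. \<Sum>j = 1..i. g j * (\<Lambda> i j * u i * u j))"
    by (intro sum.cong) (auto simp: sym)
  finally have "(\<Sum>i = 1..N. g i * loss \<Lambda> n u i)
      = (\<Sum>i = 1..n. \<Sum>j = 1..i. g j * (\<Lambda> i j * u i * u j))" .
  with * show ?thesis
    by (simp add: trunc_rhs_def right_diff_distrib left_diff_distrib sum_subtractf)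
qed

lemma mass_balance:
  assumes "n < N"
  shows "(\<Sum>i = 1..N. real i * trunc_rhs \<Lambda> n u i) = 0"
  using weak_form[OF assms, of real u] by simp

text \<open>
  The weight $\min(i,r)$ behaves like the mass below size \<open>r\<close>, where nothing is lost,
  and is constant above, where each collision loses $\min(j,r)$. Collisions between two particles
  of size at least \<open>r\<close> alone dissipate \<open>r\<close> each.
\<close>

lemma dissipation:
  assumes "n < N" "1 \<le> r" and u: "mass_le M u"
  shows "(\<Sum>i = 1..N. real (min i r) * trunc_rhs \<Lambda> n u i) \<le> - (real r / 2) * (\<Sum>i = r..n. \<theta> i * u i)\<^sup>2"
proof -
  let ?a = "\<lambda>i j. real (min j r) * (\<Lambda> i j * u i * u j)"
  have pos: "0 \<le> ?a i j" if "1 \<le> i" "1 \<le> j" for i j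
    using that u by (simp add: kernel_nonneg mass_le_nonneg)
  have "(\<Sum>i = 1..N. real (min i r) * trunc_rhs \<Lambda> n u i)
      = (\<Sum>i = 1..n. \<Sum>j = 1..i. (if r \<le> i then - ?a i j else 0))"
    unfolding weak_form[OF assms(1)] by (intro sum.cong) (auto simp: min_def algebra_simps)
  also have "\<dots> \<le> (\<Sum>i = r..n. \<Sum>j = r..i. - ?a i j)"
  proof -
    have "(\<Sum>i = 1..n. \<Sum>j = 1..i. (if r \<le> i then - ?a i j else 0))
        = (\<Sum>i = r..n. \<Sum>j = 1..i. - ?a i j)"
      using assms(2) by (intro sum.mono_neutral_cong_right) auto
    also have "\<dots> \<le> (\<Sum>i = r..n. \<Sum>j = r..i. - ?a i j)"
    proof (rule sum_mono)
      fix i assume "i \<in> {r..n}"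
      then have "(\<Sum>j = r..i. ?a i j) \<le> (\<Sum>j = 1..i. ?a i j)"
        using assms(2) pos by (intro sum_mono2) auto
      then show "(\<Sum>j = 1..i. - ?a i j) \<le> (\<Sum>j = r..i. - ?a i j)"
        by (simp add: sum_negf)
    qed
    finally show ?thesis .
  qed
  also have "\<dots> \<le> (\<Sum>i = r..n. \<Sum>j = r..i. - (real r * ((\<theta> i * u i) * (\<theta> j * u j))))"
  proof (intro sum_mono le_imp_neg_le)
    fix i j assume ij: "i \<in> {r..n}" "j \<in> {r..i}"
    then have "(\<theta> i * \<theta> j) * (u i * u j) \<le> \<Lambda> i j * (u i * u j)"
      using assms by (intro mult_right_mono theta_prod_le mult_nonneg_nonneg mass_le_nonneg[OF u]) auto
    then have "real r * ((\<theta> i * \<theta> j) * (u i * u j)) \<le> real r * (\<Lambda> i j * (u i * u j))"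
      by (rule mult_left_mono) simp
    then show "real r * ((\<theta> i * u i) * (\<theta> j * u j)) \<le> real (min j r) * (\<Lambda> i j * u i * u j)"
      using ij by (simp add: ac_simps)
  qed
  also have "\<dots> = - (real r) * (\<Sum>i = r..n. \<Sum>j = r..i. (\<theta> i * u i) * (\<theta> j * u j))"
    by (simp add: sum_negf sum_distrib_left)
  also have "\<dots> \<le> - (real r) * ((\<Sum>i = r..n. \<theta> i * u i)\<^sup>2 / 2)"
    using square_sum_le_triangle[of r n "\<lambda>i. \<theta> i * u i"] assms
    by (intro mult_left_mono_neg) (auto simp: theta_nonneg mass_le_nonneg)
  finally show ?thesis by simp
qed

text \<open>
  The negative terms of the right-hand side are \<open>u i\<close> times a rate that the mass bounds by
  $2LM$, so a step \<open>h\<close> with $2hLM \le 1$ cannot overshoot zero.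
\<close>

lemma euler_step_nonneg:
  assumes u: "mass_le M u" and i: "1 \<le> i"
    and L: "\<And>j. j \<in> {1..n} \<Longrightarrow> \<Lambda> i j \<le> L"
    and h: "0 \<le> h" "h * (2 * L * M) \<le> 1"
    and n: "i \<le> n"
  shows "0 \<le> u i + h * trunc_rhs \<Lambda> n u i"
proof -
  have L0: "0 \<le> L"
    using L[of i] kernel_nonneg[of i i] i n by simp
  have "(\<Sum>j = 1..i. real j * \<Lambda> i j * u j) \<le> (\<Sum>j = 1..i. L * (real j * u j))"
  proof (rule sum_mono)
    fix j assume "j \<in> {1..i}"
    then show "real j * \<Lambda> i j * u j \<le> L * (real j * u j)"
      using L[of j] n mult_right_mono[of "\<Lambda> i j" L "real j * u j"] mass_le_nonneg[OF u, of j]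
      by (simp add: ac_simps)
  qed
  also have "\<dots> \<le> L * M"
    using mass_le_sum[OF u, of i] L0 by (simp add: sum_distrib_left[symmetric] mult_left_mono)
  finally have 1: "(\<Sum>j = 1..i. real j * \<Lambda> i j * u j) \<le> L * M" .
  have "(\<Sum>j = i..n. \<Lambda> i j * u j) \<le> (\<Sum>j = i..n. L * (real j * u j))"
  proof (rule sum_mono)
    fix j assume j: "j \<in> {i..n}"
    then have "1 * u j \<le> real j * u j"
      using i by (intro mult_right_mono mass_le_nonneg[OF u]) auto
    then show "\<Lambda> i j * u j \<le> L * (real j * u j)"
      using L[of j] i j mass_le_nonneg[OF u, of j] L0 by (intro mult_mono) auto
  qed
  also have "\<dots> \<le> L * M"
    using mass_le_sum_subset[OF u, of "{i..n}"] L0 i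
    by (simp add: sum_distrib_left[symmetric] mult_left_mono)
  finally have 2: "(\<Sum>j = i..n. \<Lambda> i j * u j) \<le> L * M" .
  let ?s = "(\<Sum>j = 1..i. real j * \<Lambda> i j * u j) + (\<Sum>j = i..n. \<Lambda> i j * u j)"
  have "h * ?s \<le> h * (2 * L * M)"
    using 1 2 h by (intro mult_left_mono) auto
  then have "0 \<le> u i * (1 - h * ?s)"
    using h mass_le_nonneg[OF u i] by (intro mult_nonneg_nonneg) auto
  moreover have "0 \<le> h * flux \<Lambda> n u (i - 1)"
  proof (cases "i = 1")
    case False
    then show ?thesis
      using h i unfolding flux_def
      by (auto intro!: mult_nonneg_nonneg sum_nonneg kernel_nonneg mass_le_nonneg[OF u])
  qed (simp add: flux_def)
  moreover have "u i + h * trunc_rhs \<Lambda> n u i = u i * (1 - h * ?s) + h * flux \<Lambda> n u (i - 1)"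
    using n by (simp add: trunc_rhs_def flux_def[of _ _ _ i] loss_def algebra_simps)
  ultimately show ?thesis by simp
qed

text \<open>
  The bound \<open>L\<close> concerns only the finitely many rates below the truncation, so the kernel
  may be unbounded; the step shrinks with \<open>n\<close> accordingly.
\<close>

definition admissible_step :: "nat \<Rightarrow> real \<Rightarrow> real \<Rightarrow> bool" where
  "admissible_step n M h \<longleftrightarrow> 0 < h \<and> (\<exists>L. (\<forall>i\<in>{1..n}. \<forall>j\<in>{1..n}. \<Lambda> i j \<le> L) \<and> h * (2 * L * M) \<le> 1)"

lemma ex_admissible_step:
  assumes "0 \<le> M"
  shows "\<exists>h. admissible_step n M h \<and> h \<le> 1 / real (Suc n)"
proof -
  define L where "L = (\<Sum>i = 1..n. \<Sum>j = 1..n. \<Lambda> i j)"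
  have L: "\<Lambda> i j \<le> L" if "i \<in> {1..n}" "j \<in> {1..n}" for i j
  proof -
    have "\<Lambda> i j \<le> (\<Sum>j = 1..n. \<Lambda> i j)"
      using that by (intro member_le_sum) (auto intro: kernel_nonneg)
    also have "\<dots> \<le> L"
      unfolding L_def using that
      by (intro member_le_sum[of i _ "\<lambda>i. \<Sum>j = 1..n. \<Lambda> i j"]) (auto intro!: sum_nonneg kernel_nonneg)
    finally show ?thesis .
  qed
  have L0: "0 \<le> L"
    unfolding L_def by (auto intro!: sum_nonneg kernel_nonneg)
  define h where "h = 1 / (real (Suc n) + 2 * L * M)"
  have pos: "0 \<le> 2 * L * M"
    using L0 assms by simp
  have "0 < h" "h * (2 * L * M) \<le> 1" "h \<le> 1 / real (Suc n)"
    unfolding h_def using pos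
    by (auto simp: field_simps add_pos_nonneg intro: frac_le intro!: divide_pos_pos)
  then show ?thesis
    unfolding admissible_step_def using L by blast
qed

lemma mass_le_euler_step:
  assumes u: "mass_le M u" and h: "admissible_step n M h"
  shows "mass_le M (\<lambda>i. u i + h * trunc_rhs \<Lambda> n u i)" (is "mass_le M ?v")
proof -
  obtain L where L: "\<And>i j. i \<in> {1..n} \<Longrightarrow> j \<in> {1..n} \<Longrightarrow> \<Lambda> i j \<le> L" "h * (2 * L * M) \<le> 1" "0 < h"
    using h unfolding admissible_step_def by blast
  have pos: "0 \<le> ?v i" if i: "1 \<le> i" for i
  proof (cases "i \<le> n")
    case True
    then show ?thesis
      using euler_step_nonneg[OF u i L(1)] L i by simp
  next
    case False
    have "0 \<le> flux \<Lambda> n u (i - 1)"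
    proof (cases "i = 1")
      case False
      then show ?thesis
        using i unfolding flux_def
        by (auto intro!: mult_nonneg_nonneg sum_nonneg kernel_nonneg mass_le_nonneg[OF u])
    qed (simp add: flux_def)
    with False show ?thesis
      using mass_le_nonneg[OF u i] L(3) by (simp add: trunc_rhs_def flux_def[of _ _ _ i] loss_def)
  qed
  have "(\<Sum>i = 1..N. real i * ?v i) \<le> M" for N
  proof -
    have "(\<Sum>i = 1..N. real i * ?v i) \<le> (\<Sum>i = 1..N + Suc n. real i * ?v i)"
      using pos by (intro sum_mono2) auto
    also have "\<dots> = (\<Sum>i = 1..N + Suc n. real i * u i)
        + h * (\<Sum>i = 1..N + Suc n. real i * trunc_rhs \<Lambda> n u i)"
      unfolding sum_distrib_left sum.distrib[symmetric] by (intro sum.cong) (auto simp: algebra_simps)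
    also have "\<dots> = (\<Sum>i = 1..N + Suc n. real i * u i)"
      by (subst mass_balance) simp_all
    also have "\<dots> \<le> M"
      by (rule mass_le_sum[OF u])
    finally show ?thesis .
  qed
  with pos show ?thesis
    by (simp add: mass_le_def)
qed

lemma mass_le_euler:
  assumes "mass_le M u" "admissible_step n M h"
  shows "mass_le M (euler \<Lambda> n h u k)"
  by (induction k) (use assms mass_le_euler_step in auto)

lemma euler_eq_sum: "euler \<Lambda> n h u k i = u i + h * (\<Sum>l<k. trunc_rhs \<Lambda> n (euler \<Lambda> n h u l) i)"
  by (induction k) (simp_all add: algebra_simps)

text \<open>
  Time-discrete form of $\int_0^\infty (\sum_{j \ge r} \theta_j \omega_j)^2\,dt \le 2M/r$, from
  summing \<open>dissipation\<close> over the steps. The bound tends to \<open>0\<close> as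
  \<open>r\<close> grows, uniformly in the truncation, so the largest particles contribute little to
  the interaction rates in mean square over time.
\<close>

lemma gel_estimate:
  assumes u: "mass_le M u" and h: "admissible_step n M h" and r: "1 \<le> r"
  shows "h * (\<Sum>l<k. (\<Sum>j = r..n. \<theta> j * euler \<Lambda> n h u l j)\<^sup>2) \<le> 2 * M / real r"
proof -
  let ?u = "euler \<Lambda> n h u"
  let ?W = "\<lambda>u. \<Sum>i = 1..Suc n. real (min i r) * u i"
  let ?E = "\<lambda>l. (\<Sum>j = r..n. \<theta> j * ?u l j)\<^sup>2"
  have h0: "0 < h"
    using h by (simp add: admissible_step_def)
  have "?W (?u k) + real r / 2 * (h * (\<Sum>l<k. ?E l)) \<le> ?W u"
  proof (induction k)
    case (Suc k)
    have "?W (?u (Suc k)) = ?W (?u k) + h * (\<Sum>i = 1..Suc n. real (min i r) * trunc_rhs \<Lambda> n (?u k) i)"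
      unfolding sum_distrib_left sum.distrib[symmetric] by (intro sum.cong) (auto simp: algebra_simps)
    also have "\<dots> \<le> ?W (?u k) + h * (- (real r / 2) * ?E k)"
      using h0 dissipation[OF _ r mass_le_euler[OF u h], of n "Suc n" k]
      by (intro add_left_mono mult_left_mono) auto
    finally show ?case
      using Suc by (simp add: algebra_simps)
  qed simp
  moreover have "0 \<le> ?W (?u k)"
    using mass_le_nonneg[OF mass_le_euler[OF u h]] by (intro sum_nonneg) auto
  moreover have "?W u \<le> M"
  proof -
    have "?W u \<le> (\<Sum>i = 1..Suc n. real i * u i)"
      using mass_le_nonneg[OF u] by (intro sum_mono mult_right_mono) auto
    then show ?thesis
      using mass_le_sum[OF u, of "Suc n"] by simp
  qed
  ultimately have "real r / 2 * (h * (\<Sum>l<k. ?E l)) \<le> M"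
    by simp
  then show ?thesis
    using r by (simp add: field_simps)
qed

text \<open>
  The linear part of the growth bound on the kernel is controlled by the mass at each time, the part
  proportional to \<open>\<theta>\<close> only in mean square over time. With \<open>N\<close> large and
  \<open>e\<close> small the right-hand side is small on bounded time intervals; with
  \<open>N = 1\<close> it is a modulus of continuity in time.
\<close>

lemma tail_estimate:
  assumes u: "mass_le M u" and h: "admissible_step n M h" and N: "1 \<le> N"
    and eps: "0 \<le> e" and C: "0 \<le> C"
    and \<Lambda>: "\<And>j. N \<le> j \<Longrightarrow> \<Lambda> i j \<le> e * real j + C * \<theta> j"
  shows "h * (\<Sum>l = a..<b. \<Sum>j = N..n. \<Lambda> i j * euler \<Lambda> n h u l j)
    \<le> e * M * (real (b - a) * h) + C * sqrt (real (b - a) * h * (2 * M / real N))"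
proof -
  let ?u = "euler \<Lambda> n h u"
  let ?x = "\<lambda>l. \<Sum>j = N..n. \<theta> j * ?u l j"
  note ml = mass_le_euler[OF u h]
  have h0: "0 < h"
    using h by (simp add: admissible_step_def)
  have "(\<Sum>j = N..n. \<Lambda> i j * ?u l j) \<le> e * M + C * ?x l" for l
  proof -
    have "(\<Sum>j = N..n. \<Lambda> i j * ?u l j) \<le> (\<Sum>j = N..n. (e * real j + C * \<theta> j) * ?u l j)"
      using N by (intro sum_mono mult_right_mono \<Lambda> mass_le_nonneg[OF ml]) auto
    also have "\<dots> = e * (\<Sum>j = N..n. real j * ?u l j) + C * ?x l"
      by (simp add: sum_distrib_left sum.distrib algebra_simps)
    also have "\<dots> \<le> e * M + C * ?x l"
      using N by (intro add_right_mono mult_left_mono[OF _ eps] mass_le_sum_subset[OF ml]) auto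
    finally show ?thesis .
  qed
  then have "h * (\<Sum>l = a..<b. \<Sum>j = N..n. \<Lambda> i j * ?u l j) \<le> h * (\<Sum>l = a..<b. e * M + C * ?x l)"
    using h0 by (intro mult_left_mono sum_mono) auto
  also have "\<dots> = e * M * (real (b - a) * h) + C * (h * (\<Sum>l = a..<b. ?x l))"
    by (simp add: sum.distrib sum_distrib_left algebra_simps)
  also have "h * (\<Sum>l = a..<b. ?x l) \<le> sqrt (real (b - a) * h * (2 * M / real N))"
  proof (rule real_le_rsqrt)
    have "(h * (\<Sum>l = a..<b. ?x l))\<^sup>2 \<le> h\<^sup>2 * ((\<Sum>l = a..<b. (?x l)\<^sup>2) * real (b - a))"
      using sum_squared_le_sum_of_squares[of ?x "{a..<b}"]
      by (auto simp: power_mult_distrib intro!: mult_left_mono)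
    also have "\<dots> = real (b - a) * h * (h * (\<Sum>l = a..<b. (?x l)\<^sup>2))"
      by (simp add: power2_eq_square)
    also have "h * (\<Sum>l = a..<b. (?x l)\<^sup>2) \<le> h * (\<Sum>l<b. (?x l)\<^sup>2)"
      using h0 by (intro mult_left_mono sum_mono2) auto
    also have "\<dots> \<le> 2 * M / real N"
      by (rule gel_estimate[OF u h N])
    finally show "(h * (\<Sum>l = a..<b. ?x l))\<^sup>2 \<le> real (b - a) * h * (2 * M / real N)"
      using h0 by (simp add: mult_left_mono)
  qed
  finally show ?thesis
    using C by (simp add: mult_left_mono)
qed

end

section \<open>Convergence of step functions\<close>

lemma step_function_eval:
  fixes h s :: real
  assumes "0 < h"
  shows "(\<Sum>l<b. p l * indicator {real l * h..<real (Suc l) * h} s)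
    = (if 0 \<le> s \<and> s < real b * h then p (nat \<lfloor>s / h\<rfloor>) else (0::real))"
proof -
  have *: "s \<in> {real l * h..<real (Suc l) * h} \<longleftrightarrow> 0 \<le> s \<and> nat \<lfloor>s / h\<rfloor> = l" for l
  proof -
    have "s \<in> {real l * h..<real (Suc l) * h} \<longleftrightarrow> real l \<le> s / h \<and> s / h < real l + 1"
      using assms by (simp add: field_simps)
    also have "\<dots> \<longleftrightarrow> \<lfloor>s / h\<rfloor> = int l"
      by (simp add: floor_eq_iff)
    also have "\<dots> \<longleftrightarrow> 0 \<le> s \<and> nat \<lfloor>s / h\<rfloor> = l"
    proof
      assume l: "\<lfloor>s / h\<rfloor> = int l"
      then have "0 \<le> s / h"
        by (metis of_nat_0_le_iff zero_le_floor)
      with l assms show "0 \<le> s \<and> nat \<lfloor>s / h\<rfloor> = l"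
        by (simp add: zero_le_divide_iff)
    next
      assume "0 \<le> s \<and> nat \<lfloor>s / h\<rfloor> = l"
      moreover from this have "0 \<le> \<lfloor>s / h\<rfloor>"
        using assms by simp
      ultimately show "\<lfloor>s / h\<rfloor> = int l"
        by (metis nat_0_le)
    qed
    finally show ?thesis .
  qed
  have lt: "nat \<lfloor>s / h\<rfloor> < b \<longleftrightarrow> s < real b * h" if "0 \<le> s"
  proof -
    have "0 \<le> \<lfloor>s / h\<rfloor>"
      using that assms by simp
    then have "nat \<lfloor>s / h\<rfloor> < b \<longleftrightarrow> \<lfloor>s / h\<rfloor> < int b"
      by (simp add: nat_less_iff)
    also have "\<dots> \<longleftrightarrow> s / h < real b"
      by (simp add: floor_less_iff)
    finally show ?thesis
      using assms by (simp add: field_simps)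
  qed
  have "(\<Sum>l<b. p l * indicator {real l * h..<real (Suc l) * h} s)
      = (\<Sum>l<b. if l = nat \<lfloor>s / h\<rfloor> then (if 0 \<le> s then p l else 0) else 0)"
    unfolding indicator_def of_bool_def * by (intro sum.cong) auto
  also have "\<dots> = (if 0 \<le> s \<and> s < real b * h then p (nat \<lfloor>s / h\<rfloor>) else 0)"
    using lt by (subst sum.delta) auto
  finally show ?thesis .
qed

lemma grid_floor:
  fixes h t :: real
  assumes "0 < h" "0 \<le> t"
  shows "real (nat \<lfloor>t / h\<rfloor>) * h \<le> t" "t - h < real (nat \<lfloor>t / h\<rfloor>) * h"
proof -
  have "real (nat \<lfloor>t / h\<rfloor>) = of_int \<lfloor>t / h\<rfloor>"
    using assms by simp
  moreover have "of_int \<lfloor>t / h\<rfloor> * h \<le> t"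
    using assms by (metis of_int_floor_le pos_le_divide_eq)
  moreover have "t / h < of_int \<lfloor>t / h\<rfloor> + 1"
    by linarith
  ultimately show "real (nat \<lfloor>t / h\<rfloor>) * h \<le> t" "t - h < real (nat \<lfloor>t / h\<rfloor>) * h"
    using assms by (simp_all add: field_simps)
qed

text \<open>
  A Riemann-sum statement in which the summands depend on the mesh: the sum is the integral of a step
  function on \<open>[0, t]\<close>, to which dominated convergence applies. It lets the limit of the
  scheme be taken directly in the discrete sums.
\<close>

lemma
  fixes p :: "nat \<Rightarrow> nat \<Rightarrow> real" and h :: "nat \<Rightarrow> real"
  assumes h: "\<And>n. 0 < h n" "h \<longlonglongrightarrow> 0"
    and bound: "\<And>n l. \<bar>p n l\<bar> \<le> B"
    and conv: "\<And>s. 0 \<le> s \<Longrightarrow> (\<lambda>n. p n (nat \<lfloor>s / h n\<rfloor>)) \<longlonglongrightarrow> P s"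
    and t: "0 \<le> t"
  shows step_sum_limit_integrable: "set_integrable lborel {0..t} P"
    and step_sum_tendsto_integral:
      "(\<lambda>n. h n * (\<Sum>l<nat \<lfloor>t / h n\<rfloor>. p n l)) \<longlonglongrightarrow> (LBINT s:{0..t}. P s)"
proof -
  define b where "b n = nat \<lfloor>t / h n\<rfloor>" for n
  define f where "f n s = (\<Sum>l<b n. p n l * indicator {real l * h n..<real (Suc l) * h n} s)" for n s
  have f: "f n s = (if 0 \<le> s \<and> s < real (b n) * h n then p n (nat \<lfloor>s / h n\<rfloor>) else 0)" for n s
    unfolding f_def by (rule step_function_eval[OF h(1)])
  have bt: "real (b n) * h n \<le> t" "t - h n < real (b n) * h n" for n
    unfolding b_def using grid_floor[OF h(1) t] by auto
  \<comment> \<open>The last grid point lies at or below \<open>t\<close>, so every step function vanishes at \<open>t\<close>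
    itself; the half-open interval makes the limit hold everywhere.\<close>
  have lim: "(\<lambda>n. f n s) \<longlonglongrightarrow> indicator {0..<t} s * P s" for s
  proof (cases "s \<in> {0..<t}")
    case True
    then have "eventually (\<lambda>n. h n < t - s) sequentially"
      using h(2) by (intro order_tendstoD) auto
    then have "eventually (\<lambda>n. p n (nat \<lfloor>s / h n\<rfloor>) = f n s) sequentially"
    proof eventually_elim
      case (elim n)
      then show ?case
        using True bt(2)[of n] by (simp add: f)
    qed
    then have "(\<lambda>n. f n s) \<longlonglongrightarrow> P s"
      using conv[of s] True by (auto elim: Lim_transform_eventually)
    with True show ?thesis by simp
  next
    case False
    then have "f n s = 0" for n
      using bt(1)[of n] by (auto simp: f)
    with False show ?thesis by simp
  qed
  have meas: "f n \<in> borel_measurable lborel" for n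
    unfolding f_def by measurable
  have B0: "0 \<le> B"
    using bound[of 0 0] by linarith
  have dom: "norm (f n s) \<le> B * indicator {0..t} s" for n s
    using bound[of n] bt(1)[of n] B0 by (auto simp: f indicator_def)
  have meas': "(\<lambda>s. indicator {0..<t} s * P s) \<in> borel_measurable lborel"
    by (rule borel_measurable_LIMSEQ_real[OF lim meas])
  have intB: "integrable lborel (\<lambda>s. B * indicator {0..t} s)"
    using t by simp
  have ae: "AE s in lborel. indicator {0..<t} s * P s = indicator {0..t} s *\<^sub>R P s"
    using AE_lborel_singleton[of t] by eventually_elim (auto simp: indicator_def)
  have m2: "(\<lambda>s. indicator {0..t} s *\<^sub>R P s) \<in> borel_measurable lborel"
  proof -
    have "(\<lambda>s. indicator {0..t} s *\<^sub>R P s)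
        = (\<lambda>s. indicator {0..<t} s * P s + P t * indicator {t} s)"
      using t by (auto simp: fun_eq_iff indicator_def)
    moreover have "(\<lambda>s. P t * indicator {t} s) \<in> borel_measurable lborel"
      by measurable
    ultimately show ?thesis
      using meas' by simp
  qed
  have int: "integrable lborel (\<lambda>s. indicator {0..<t} s * P s)"
    and lim': "(\<lambda>n. integral\<^sup>L lborel (f n)) \<longlonglongrightarrow> (\<integral>s. indicator {0..<t} s * P s \<partial>lborel)"
    using integrable_dominated_convergence[OF meas' meas intB AE_I2[OF lim] AE_I2[OF dom]]
      integral_dominated_convergence[OF meas' meas intB AE_I2[OF lim] AE_I2[OF dom]] by auto
  show "set_integrable lborel {0..t} P"
    unfolding set_integrable_def using integrable_cong_AE[OF meas' m2 ae] int by blast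
  have "integral\<^sup>L lborel (f n) = h n * (\<Sum>l<b n. p n l)" for n
  proof -
    have "integral\<^sup>L lborel (f n)
        = (\<Sum>l<b n. p n l * measure lborel {real l * h n..<real (Suc l) * h n})"
      unfolding f_def using h(1)[of n] by (subst Bochner_Integration.integral_sum) auto
    also have "\<dots> = (\<Sum>l<b n. p n l * h n)"
      using h(1)[of n] by (intro sum.cong) (auto simp: algebra_simps)
    finally show ?thesis
      by (simp add: sum_distrib_left mult.commute)
  qed
  then show "(\<lambda>n. h n * (\<Sum>l<nat \<lfloor>t / h n\<rfloor>. p n l)) \<longlonglongrightarrow> (LBINT s:{0..t}. P s)"
    using lim' integral_cong_AE[OF meas' m2 ae] by (simp add: b_def set_lebesgue_integral_def)
qed

text \<open>
  The functions \<open>v n i\<close> may be discontinuous, but their oscillation at small distances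
  becomes small as \<open>n\<close> grows. This is enough to upgrade convergence at rational times,
  obtained by a diagonal argument over all \<open>i\<close>, to convergence at all times with continuous
  limits.
\<close>

lemma asymptotic_ascoli:
  fixes v :: "nat \<Rightarrow> 'i \<Rightarrow> real \<Rightarrow> real"
  assumes I: "countable I"
    and bound: "\<And>n i t. i \<in> I \<Longrightarrow> 0 \<le> t \<Longrightarrow> \<bar>v n i t\<bar> \<le> B"
    and equi: "\<And>i e. i \<in> I \<Longrightarrow> 0 < e \<Longrightarrow> \<exists>d>0. \<forall>\<^sub>F n in sequentially.
      \<forall>s\<ge>0. \<forall>t\<ge>0. \<bar>s - t\<bar> < d \<longrightarrow> \<bar>v n i s - v n i t\<bar> \<le> e"
  obtains k w where "strict_mono k"
    "\<And>i t. i \<in> I \<Longrightarrow> 0 \<le> t \<Longrightarrow> (\<lambda>n. v (k n) i t) \<longlonglongrightarrow> w i t"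
    "\<And>i. i \<in> I \<Longrightarrow> continuous_on {0..} (w i)"
proof -
  let ?S = "I \<times> (\<rat> \<inter> {0..})"
  have "countable ?S"
    using I countable_rat by auto
  moreover have "norm (v n (fst x) (snd x)) \<le> B" if "x \<in> ?S" for n x
    using that bound by auto
  ultimately obtain k where k: "strict_mono k"
    and kq: "\<And>x. x \<in> ?S \<Longrightarrow> \<exists>l. (\<lambda>n. v (k n) (fst x) (snd x)) \<longlonglongrightarrow> l"
    using function_convergent_subsequence[of ?S "\<lambda>n x. v n (fst x) (snd x)" B] by metis
  have "convergent (\<lambda>n. v (k n) i t)" if i: "i \<in> I" and t: "0 \<le> t" for i t
  proof (rule Cauchy_convergent, rule metric_CauchyI)
    fix e :: real assume e: "0 < e"
    obtain d where d: "0 < d" "\<forall>\<^sub>F n in sequentially.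
      \<forall>s\<ge>0. \<forall>t\<ge>0. \<bar>s - t\<bar> < d \<longrightarrow> \<bar>v n i s - v n i t\<bar> \<le> e / 4"
      using equi[OF i, of "e / 4"] e by auto
    obtain q where q: "q \<in> \<rat>" "t < q" "q < t + d"
      using Rats_dense_in_real[of t "t + d"] d(1) by auto
    have "Cauchy (\<lambda>n. v (k n) i q)"
      using kq[of "(i, q)"] i q t by (auto intro: LIMSEQ_imp_Cauchy)
    then obtain N1 where N1: "\<And>m n. m \<ge> N1 \<Longrightarrow> n \<ge> N1 \<Longrightarrow> dist (v (k m) i q) (v (k n) i q) < e / 4"
      using e metric_CauchyD[of "\<lambda>n. v (k n) i q" "e / 4"] by auto
    obtain N2 where N2: "\<And>n. n \<ge> N2 \<Longrightarrow> \<bar>v (k n) i q - v (k n) i t\<bar> \<le> e / 4"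
      using eventually_subseq[OF k d(2)] q t unfolding eventually_sequentially by force
    show "\<exists>N. \<forall>m\<ge>N. \<forall>n\<ge>N. dist (v (k m) i t) (v (k n) i t) < e"
    proof (intro exI allI impI)
      fix m n assume "m \<ge> max N1 N2" "n \<ge> max N1 N2"
      then show "dist (v (k m) i t) (v (k n) i t) < e"
        using N1[of m n] N2[of m] N2[of n] e
        unfolding dist_real_def abs_less_iff abs_le_iff by simp
    qed
  qed
  then have w: "(\<lambda>n. v (k n) i t) \<longlonglongrightarrow> lim (\<lambda>n. v (k n) i t)" if "i \<in> I" "0 \<le> t" for i t
    using that by (simp add: convergent_LIMSEQ_iff)
  show ?thesis
  proof (rule that[of k "\<lambda>i t. lim (\<lambda>n. v (k n) i t)"])
    fix i assume i: "i \<in> I"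
    show "continuous_on {0..} (\<lambda>t. lim (\<lambda>n. v (k n) i t))"
      unfolding continuous_on_iff
    proof (intro ballI allI impI)
      fix t e :: real assume t: "t \<in> {0..}" and e: "0 < e"
      obtain d where d: "0 < d" "\<forall>\<^sub>F n in sequentially.
        \<forall>s\<ge>0. \<forall>t\<ge>0. \<bar>s - t\<bar> < d \<longrightarrow> \<bar>v n i s - v n i t\<bar> \<le> e / 2"
        using equi[OF i, of "e / 2"] e by auto
      have "dist (lim (\<lambda>n. v (k n) i s)) (lim (\<lambda>n. v (k n) i t)) < e"
        if s: "s \<in> {0..}" "dist s t < d" for s
      proof -
        have "\<forall>\<^sub>F n in sequentially. \<bar>v (k n) i s - v (k n) i t\<bar> \<le> e / 2"
          using eventually_subseq[OF k d(2)] by eventually_elim (use s t in \<open>auto simp: dist_real_def\<close>)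
        moreover have "(\<lambda>n. \<bar>v (k n) i s - v (k n) i t\<bar>)
            \<longlonglongrightarrow> \<bar>lim (\<lambda>n. v (k n) i s) - lim (\<lambda>n. v (k n) i t)\<bar>"
          using s t by (intro tendsto_intros w i) auto
        ultimately have "\<bar>lim (\<lambda>n. v (k n) i s) - lim (\<lambda>n. v (k n) i t)\<bar> \<le> e / 2"
          by (intro tendsto_upperbound) auto
        with e show ?thesis
          by (simp add: dist_real_def)
      qed
      with d(1) show "\<exists>d>0. \<forall>s\<in>{0..}. dist s t < d \<longrightarrow>
          dist (lim (\<lambda>n. v (k n) i s)) (lim (\<lambda>n. v (k n) i t)) < e"
        by blast
    qed
  qed (use k w in auto)
qed

text \<open>
  Monotone convergence for series: a bound on the integrals of the partial sums gives convergence
  almost everywhere, integrability of the sum, and the exchange of sum and integral.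
\<close>

lemma
  fixes f :: "nat \<Rightarrow> real \<Rightarrow> real"
  assumes int: "\<And>j. set_integrable lborel A (f j)"
    and nonneg: "\<And>j s. s \<in> A \<Longrightarrow> 0 \<le> f j s"
    and bound: "\<And>N. (\<Sum>j<N. LBINT s:A. f j s) \<le> K"
  shows AE_summable_of_integral_bound: "AE s in lborel. s \<in> A \<longrightarrow> summable (\<lambda>j. f j s)"
    and set_integrable_suminf_of_bound: "set_integrable lborel A (\<lambda>s. \<Sum>j. f j s)"
    and set_integral_sums_of_bound:
      "(\<lambda>j. LBINT s:A. f j s) sums (LBINT s:A. \<Sum>j. f j s)"
proof -
  define g where "g j s = indicator A s *\<^sub>R f j s" for j s
  have gi: "integrable lborel (g j)" for j
    using int[of j] unfolding set_integrable_def g_def .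
  have g0: "0 \<le> g j s" for j s
    using nonneg by (auto simp: g_def indicator_def)
  have gL: "(LBINT s:A. f j s) = integral\<^sup>L lborel (g j)" for j
    unfolding set_lebesgue_integral_def g_def ..
  have summ: "summable (\<lambda>j. integral\<^sup>L lborel (g j))"
    using bound unfolding gL by (intro summableI_nonneg_bounded[where x=K]) (simp_all add: g0)
  have "(\<integral>\<^sup>+ s. (\<Sum>j. ennreal (g j s)) \<partial>lborel) = (\<Sum>j. \<integral>\<^sup>+ s. ennreal (g j s) \<partial>lborel)"
    using gi by (intro nn_integral_suminf) auto
  also have "\<dots> = (\<Sum>j. ennreal (integral\<^sup>L lborel (g j)))"
    by (intro suminf_cong nn_integral_eq_integral gi) (simp add: g0)
  also have "\<dots> \<noteq> \<infinity>"
    using summ by (simp add: ennreal_suminf_neq_top g0)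
  finally have "AE s in lborel. (\<Sum>j. ennreal (g j s)) \<noteq> \<infinity>"
    using gi by (intro nn_integral_noteq_infinite) auto
  then have AEg: "AE s in lborel. summable (\<lambda>j. g j s)"
    by eventually_elim (auto intro!: summable_suminf_not_top g0)
  then show "AE s in lborel. s \<in> A \<longrightarrow> summable (\<lambda>j. f j s)"
    by eventually_elim (auto simp: g_def)
  have *: "AE s in lborel. summable (\<lambda>j. norm (g j s))"
    using AEg by (simp add: g0)
  have **: "summable (\<lambda>j. \<integral>s. norm (g j s) \<partial>lborel)"
    using summ by (simp add: g0)
  have eq: "(\<lambda>s. \<Sum>j. g j s) = (\<lambda>s. indicator A s *\<^sub>R (\<Sum>j. f j s))"
    by (auto simp: g_def indicator_def fun_eq_iff)
  show "set_integrable lborel A (\<lambda>s. \<Sum>j. f j s)"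
    using integrable_suminf[OF gi * **] unfolding set_integrable_def eq .
  show "(\<lambda>j. LBINT s:A. f j s) sums (LBINT s:A. \<Sum>j. f j s)"
    using sums_integral[OF gi * **] unfolding gL unfolding set_lebesgue_integral_def eq .
qed

section \<open>Equicontinuity of the scheme\<close>

context sd_kernel
begin

lemma abs_flux_le:
  assumes u: "mass_le M u"
  shows "\<bar>flux \<Lambda> n u i\<bar> \<le> M * (\<Sum>j = 1..i. real j * \<Lambda> i j * M)"
proof -
  have M: "0 \<le> M"
    using mass_le_sum[OF u, of 0] by simp
  show ?thesis
  proof (cases "1 \<le> i")
    case True
    have "(\<Sum>j = 1..i. real j * \<Lambda> i j * u j) \<le> (\<Sum>j = 1..i. real j * \<Lambda> i j * M)"
      using True by (intro sum_mono mult_left_mono mass_le_component[OF u] mult_nonneg_nonneg kernel_nonneg) auto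
    moreover have "0 \<le> (\<Sum>j = 1..i. real j * \<Lambda> i j * u j)"
      using True by (intro sum_nonneg mult_nonneg_nonneg kernel_nonneg mass_le_nonneg[OF u]) auto
    ultimately show ?thesis
      using mass_le_component[OF u True] mass_le_nonneg[OF u True] M
      by (auto simp: flux_def abs_mult intro!: mult_mono mult_nonneg_nonneg)
  qed (simp add: flux_def)
qed

lemma loss_bounds:
  assumes u: "mass_le M u" and i: "1 \<le> i"
  shows "0 \<le> loss \<Lambda> n u i" "loss \<Lambda> n u i \<le> M * (\<Sum>j = 1..n. \<Lambda> i j * u j)"
proof -
  have "0 \<le> (\<Sum>j = i..n. \<Lambda> i j * u j)"
    using i by (intro sum_nonneg mult_nonneg_nonneg kernel_nonneg mass_le_nonneg[OF u]) auto
  moreover have "(\<Sum>j = i..n. \<Lambda> i j * u j) \<le> (\<Sum>j = 1..n. \<Lambda> i j * u j)"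
    using i by (intro sum_mono2 mult_nonneg_nonneg kernel_nonneg mass_le_nonneg[OF u]) auto
  ultimately show "0 \<le> loss \<Lambda> n u i" "loss \<Lambda> n u i \<le> M * (\<Sum>j = 1..n. \<Lambda> i j * u j)"
    using mass_le_component[OF u i] mass_le_nonneg[OF u i]
    by (auto simp: loss_def intro!: mult_mono)
qed

text \<open>
  The common consequence of the two alternatives for the kernel: up to a sublinear remainder, a row of
  the kernel grows at most like \<open>\<theta>\<close>.
\<close>

definition tail_growth :: "nat \<Rightarrow> real \<Rightarrow> bool" where
  "tail_growth i C \<longleftrightarrow> 0 \<le> C \<and> (\<forall>e>0. \<forall>\<^sub>F j in sequentially. \<Lambda> i j \<le> e * real j + C * \<theta> j)"

text \<open>
  The finitely many indices at which the bound may fail are absorbed into the linear term.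
\<close>

lemma tail_growth_from_one:
  assumes C: "tail_growth i C" and i: "1 \<le> i"
  obtains D where "0 \<le> D" "\<And>j. 1 \<le> j \<Longrightarrow> \<Lambda> i j \<le> D * real j + C * \<theta> j"
proof -
  have "\<forall>\<^sub>F j in sequentially. \<Lambda> i j \<le> 1 * real j + C * \<theta> j"
    using C unfolding tail_growth_def by (meson zero_less_one)
  then obtain N where N: "\<And>j. j \<ge> N \<Longrightarrow> \<Lambda> i j \<le> real j + C * \<theta> j"
    unfolding eventually_sequentially by auto
  define S where "S = (\<Sum>j = 1..N. \<Lambda> i j)"
  have S0: "0 \<le> S"
    unfolding S_def using i by (intro sum_nonneg kernel_nonneg) auto
  show ?thesis
  proof (rule that[of "1 + S"])
    fix j :: nat assume j: "1 \<le> j"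
    have "0 \<le> C * \<theta> j"
      using C theta_nonneg[OF j] by (simp add: tail_growth_def)
    show "\<Lambda> i j \<le> (1 + S) * real j + C * \<theta> j"
    proof (cases "j \<ge> N")
      case True
      then show ?thesis
        using N[of j] mult_nonneg_nonneg[OF S0, of "real j"] by (simp add: algebra_simps)
    next
      case False
      then have "\<Lambda> i j \<le> S"
        unfolding S_def using i j by (intro member_le_sum kernel_nonneg) auto
      also have "S * 1 \<le> (1 + S) * real j"
        using S0 j by (intro mult_mono) auto
      finally show ?thesis
        using \<open>0 \<le> C * \<theta> j\<close> by simp
    qed
  qed (use S0 in simp)
qed

text \<open>
  The square root is the price for the part of the loss rate that is bounded only in mean square; the
  constants depend on \<open>i\<close> and \<open>M\<close> but not on the truncation or the step.
\<close>

lemma euler_modulus: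
  assumes C: "tail_growth i C" and i: "1 \<le> i"
  obtains A B where "0 \<le> A" "0 \<le> B"
    "\<And>n h u a b. mass_le M u \<Longrightarrow> admissible_step n M h \<Longrightarrow> a \<le> b \<Longrightarrow>
      \<bar>euler \<Lambda> n h u b i - euler \<Lambda> n h u a i\<bar> \<le> A * (real (b - a) * h) + B * sqrt (real (b - a) * h)"
proof (cases "0 \<le> M")
  case False
  then have "\<not> mass_le M u" for u
    using mass_le_sum[of M u 0] by auto
  then show ?thesis
    using that[of 0 0] by simp
next
  case M: True
  obtain D where D: "0 \<le> D" "\<And>j. 1 \<le> j \<Longrightarrow> \<Lambda> i j \<le> D * real j + C * \<theta> j"
    using tail_growth_from_one[OF C i] by blast
  have C0: "0 \<le> C"
    using C by (simp add: tail_growth_def)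
  define F where "F i = M * (\<Sum>j = 1..i. real j * \<Lambda> i j * M)" for i
  have F0: "0 \<le> F i" for i
    unfolding F_def using M by (cases "i = 0") (auto intro!: mult_nonneg_nonneg sum_nonneg kernel_nonneg)
  let ?c = "F (i - 1) + F i"
  show ?thesis
  proof (rule that[of "?c + M * (D * M)" "M * (C * sqrt (2 * M))"])
    show "0 \<le> ?c + M * (D * M)" "0 \<le> M * (C * sqrt (2 * M))"
      using F0 M D(1) C0 by auto
  next
    fix n h u and a b :: nat
    assume u: "mass_le M u" and h: "admissible_step n M h" and ab: "a \<le> b"
    let ?u = "euler \<Lambda> n h u"
    note ml = mass_le_euler[OF u h]
    have h0: "0 < h"
      using h by (simp add: admissible_step_def)
    have rhs: "\<bar>trunc_rhs \<Lambda> n (?u l) i\<bar> \<le> ?c + M * (\<Sum>j = 1..n. \<Lambda> i j * ?u l j)" for l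
      using abs_flux_le[OF ml, of n l "i - 1"] abs_flux_le[OF ml, of n l i] loss_bounds[OF ml i, of n l]
      unfolding trunc_rhs_def F_def by linarith
    have "?u b i - ?u a i = h * (\<Sum>l = a..<b. trunc_rhs \<Lambda> n (?u l) i)"
    proof -
      have "(\<Sum>l<b. trunc_rhs \<Lambda> n (?u l) i)
          = (\<Sum>l<a. trunc_rhs \<Lambda> n (?u l) i) + (\<Sum>l = a..<b. trunc_rhs \<Lambda> n (?u l) i)"
        using ab by (metis lessThan_atLeast0 sum.atLeastLessThan_concat zero_le)
      then show ?thesis
        by (subst (1 2) euler_eq_sum) (simp add: algebra_simps)
    qed
    then have "\<bar>?u b i - ?u a i\<bar> \<le> h * (\<Sum>l = a..<b. \<bar>trunc_rhs \<Lambda> n (?u l) i\<bar>)"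
      using h0 by (simp add: abs_mult)
    also have "\<dots> \<le> h * (\<Sum>l = a..<b. ?c + M * (\<Sum>j = 1..n. \<Lambda> i j * ?u l j))"
      using h0 rhs by (intro mult_left_mono sum_mono) auto
    also have "\<dots> = ?c * (real (b - a) * h) + M * (h * (\<Sum>l = a..<b. \<Sum>j = 1..n. \<Lambda> i j * ?u l j))"
      by (simp add: sum.distrib sum_distrib_left algebra_simps)
    also have "\<dots> \<le> ?c * (real (b - a) * h)
        + M * (D * M * (real (b - a) * h) + C * sqrt (real (b - a) * h * (2 * M / real 1)))"
      using D C0 by (intro add_left_mono mult_left_mono[OF _ M] tail_estimate[OF u h]) auto
    also have "\<dots> = (?c + M * (D * M)) * (real (b - a) * h)
        + M * (C * sqrt (2 * M)) * sqrt (real (b - a) * h)"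
      by (simp add: algebra_simps real_sqrt_mult)
    finally show "\<bar>?u b i - ?u a i\<bar> \<le> (?c + M * (D * M)) * (real (b - a) * h)
        + M * (C * sqrt (2 * M)) * sqrt (real (b - a) * h)" .
  qed
qed

lemma step_function_equicontinuous:
  assumes C: "tail_growth i C" and i: "1 \<le> i"
    and u: "mass_le M u" and adm: "\<And>n. admissible_step n M (h n)" and h: "h \<longlonglongrightarrow> 0" and e: "0 < e"
  shows "\<exists>d>0. \<forall>\<^sub>F n in sequentially. \<forall>s\<ge>0. \<forall>t\<ge>0. \<bar>s - t\<bar> < d \<longrightarrow>
    \<bar>euler \<Lambda> n (h n) u (nat \<lfloor>s / h n\<rfloor>) i - euler \<Lambda> n (h n) u (nat \<lfloor>t / h n\<rfloor>) i\<bar> \<le> e"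
proof -
  obtain A B where AB: "0 \<le> A" "0 \<le> B" and *: "\<And>n h u a b. mass_le M u \<Longrightarrow> admissible_step n M h \<Longrightarrow> a \<le> b \<Longrightarrow>
      \<bar>euler \<Lambda> n h u b i - euler \<Lambda> n h u a i\<bar> \<le> A * (real (b - a) * h) + B * sqrt (real (b - a) * h)"
    using euler_modulus[OF C i, of M] by metis
  have h0: "0 < h n" for n
    using adm[of n] by (simp add: admissible_step_def)
  have "((\<lambda>x. A * x + B * sqrt x) \<longlongrightarrow> A * 0 + B * sqrt 0) (at 0)"
    by (intro tendsto_intros)
  then obtain d where d: "0 < d" "\<And>x. x \<noteq> 0 \<Longrightarrow> \<bar>x\<bar> < d \<Longrightarrow> \<bar>A * x + B * sqrt x\<bar> < e"
    using e LIM_D[of "\<lambda>x. A * x + B * sqrt x" 0 0 e] by auto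
  have small: "A * x + B * sqrt x \<le> e" if "0 \<le> x" "x < d" for x
    using d(2)[of x] that e by (cases "x = 0") auto
  have "\<forall>\<^sub>F n in sequentially. h n < d / 2"
    using h d(1) by (intro order_tendstoD) auto
  then have "\<forall>\<^sub>F n in sequentially. \<forall>s\<ge>0. \<forall>t\<ge>0. \<bar>s - t\<bar> < d / 2 \<longrightarrow>
    \<bar>euler \<Lambda> n (h n) u (nat \<lfloor>s / h n\<rfloor>) i - euler \<Lambda> n (h n) u (nat \<lfloor>t / h n\<rfloor>) i\<bar> \<le> e"
  proof eventually_elim
    case (elim n)
    have ord: "\<bar>euler \<Lambda> n (h n) u (nat \<lfloor>t / h n\<rfloor>) i - euler \<Lambda> n (h n) u (nat \<lfloor>s / h n\<rfloor>) i\<bar> \<le> e"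
      if st: "0 \<le> s" "s \<le> t" "t - s < d / 2" for s t
    proof -
      let ?a = "nat \<lfloor>s / h n\<rfloor>" and ?b = "nat \<lfloor>t / h n\<rfloor>"
      have ab: "?a \<le> ?b"
        using st h0[of n] by (intro nat_mono floor_mono divide_right_mono) auto
      have "real (?b - ?a) * h n < d"
        using grid_floor[OF h0[of n], of s] grid_floor[OF h0[of n], of t] st ab elim
        by (simp add: of_nat_diff left_diff_distrib)
      then show ?thesis
        using *[OF u adm ab] h0[of n] by (intro order_trans[OF _ small]) auto
    qed
    show ?case
    proof (intro allI impI)
      fix s t :: real assume "0 \<le> s" "0 \<le> t" "\<bar>s - t\<bar> < d / 2"
      then show "\<bar>euler \<Lambda> n (h n) u (nat \<lfloor>s / h n\<rfloor>) i - euler \<Lambda> n (h n) u (nat \<lfloor>t / h n\<rfloor>) i\<bar> \<le> e"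
        using ord[of s t] ord[of t s] by (cases "s \<le> t") (auto simp: abs_minus_commute)
    qed
  qed
  then show ?thesis
    using d(1) by (intro exI[of _ "d / 2"]) auto
qed

section \<open>Passage to the limit\<close>

theorem sd_solution_exists:
  assumes \<omega>in: "mass_le M \<omega>in"
    and growth: "\<And>i. 1 \<le> i \<Longrightarrow> \<exists>C. tail_growth i C"
  shows "\<exists>\<omega>. sd_solution \<Lambda> \<omega>in \<infinity> \<omega> \<and> (\<forall>t\<ge>0. mass_le M (\<lambda>i. \<omega> i t))"
proof -
  have M: "0 \<le> M"
    using mass_le_sum[OF \<omega>in, of 0] by simp
  obtain h where adm: "\<And>n. admissible_step n M (h n)" and h_le: "\<And>n. h n \<le> 1 / real (Suc n)"
    using ex_admissible_step[OF M] by metis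
  have h0: "0 < h n" for n
    using adm[of n] by (simp add: admissible_step_def)
  have "h \<longlonglongrightarrow> 0"
  proof (rule tendsto_sandwich)
    show "\<forall>\<^sub>F n in sequentially. h n \<le> inverse (real (Suc n))"
      using h_le by (simp add: inverse_eq_divide)
    show "\<forall>\<^sub>F n in sequentially. 0 \<le> h n"
      using h0 by (intro always_eventually allI less_imp_le)
  qed (use LIMSEQ_inverse_real_of_nat in auto)
  define v where "v n i t = euler \<Lambda> n (h n) \<omega>in (nat \<lfloor>t / h n\<rfloor>) i" for n i t
  note ml0 = mass_le_euler[OF \<omega>in adm]
  have bnd: "\<bar>v n i t\<bar> \<le> M" if "i \<in> {1..}" for n i t
    using that mass_le_nonneg[OF ml0, of i] mass_le_component[OF ml0, of i] by (simp add: v_def)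
  obtain k \<omega> where k: "strict_mono k"
    and lim: "\<And>i t. i \<in> {1..} \<Longrightarrow> 0 \<le> t \<Longrightarrow> (\<lambda>n. v (k n) i t) \<longlonglongrightarrow> \<omega> i t"
    and cont: "\<And>i. i \<in> {1..} \<Longrightarrow> continuous_on {0..} (\<omega> i)"
  proof (rule asymptotic_ascoli[of "{1..}" v M])
    fix i :: nat and e :: real assume "i \<in> {1..}" "0 < e"
    then show "\<exists>d>0. \<forall>\<^sub>F n in sequentially. \<forall>s\<ge>0. \<forall>t\<ge>0. \<bar>s - t\<bar> < d \<longrightarrow> \<bar>v n i s - v n i t\<bar> \<le> e"
      using growth[of i] step_function_equicontinuous[OF _ _ \<omega>in adm \<open>h \<longlonglongrightarrow> 0\<close>]
      unfolding v_def by auto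
  qed (use bnd in auto)
  define H where "H n = h (k n)" for n
  define U where "U n = euler \<Lambda> (k n) (H n) \<omega>in" for n
  have H0: "0 < H n" for n
    by (simp add: H_def h0)
  have H: "H \<longlonglongrightarrow> 0"
    unfolding H_def using LIMSEQ_subseq_LIMSEQ[OF \<open>h \<longlonglongrightarrow> 0\<close> k] by (simp add: o_def)
  have admH: "admissible_step (k n) M (H n)" for n
    by (simp add: H_def adm)
  have ml: "mass_le M (U n l)" for n l
    unfolding U_def by (rule mass_le_euler[OF \<omega>in admH])
  note U_nonneg = mass_le_nonneg[OF ml] and U_le = mass_le_component[OF ml]
  have U_lim: "(\<lambda>n. U n (nat \<lfloor>t / H n\<rfloor>) i) \<longlonglongrightarrow> \<omega> i t" if "1 \<le> i" "0 \<le> t" for i t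
    using lim[of i t] that by (simp add: v_def U_def H_def)
  have mlw: "mass_le M (\<lambda>i. \<omega> i t)" if t: "0 \<le> t" for t
    unfolding mass_le_def
  proof (intro conjI allI impI)
    fix i :: nat assume "1 \<le> i"
    then show "0 \<le> \<omega> i t"
      using U_nonneg by (intro tendsto_lowerbound[OF U_lim[OF _ t]]) auto
  next
    fix N
    have "(\<lambda>n. \<Sum>i = 1..N. real i * U n (nat \<lfloor>t / H n\<rfloor>) i) \<longlonglongrightarrow> (\<Sum>i = 1..N. real i * \<omega> i t)"
      using t by (intro tendsto_intros U_lim) auto
    then show "(\<Sum>i = 1..N. real i * \<omega> i t) \<le> M"
      using mass_le_sum[OF ml] by (intro tendsto_upperbound) auto
  qed
  note w_nonneg = mass_le_nonneg[OF mlw] and w_le = mass_le_component[OF mlw]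
  have k_ge: "\<forall>\<^sub>F n in sequentially. N \<le> k n" for N
    using filterlim_subseq[OF k] by (simp add: filterlim_at_top)

  have sol: "(AE s in lborel. s \<in> {0<..<t} \<longrightarrow> summable (\<lambda>j. \<Lambda> i (Suc j) * \<omega> (Suc j) s)) \<and>
           set_integrable lborel {0<..<t} (\<lambda>s. \<Sum>j. \<Lambda> i (Suc j) * \<omega> (Suc j) s) \<and>
           \<omega> i t = \<omega>in i + (LBINT s:{0..t}. sd_rhs \<Lambda> (\<lambda>k. \<omega> k s) i)"
    if i: "1 \<le> i" and t: "0 \<le> t" for i t
  proof -
    obtain C where C: "tail_growth i C"
      using growth[OF i] by blast
    then have C0: "0 \<le> C"
      by (simp add: tail_growth_def)
    define b where "b n = nat \<lfloor>t / H n\<rfloor>" for n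
    have bH: "real (b n) * H n \<le> t" for n
      unfolding b_def using grid_floor[OF H0 t] by simp
    have tail: "H n * (\<Sum>l<b n. \<Sum>j = N..k n. \<Lambda> i j * U n l j) \<le> e * M * t + C * sqrt (t * (2 * M / real N))"
      if "1 \<le> N" "0 \<le> e" "\<And>j. N \<le> j \<Longrightarrow> \<Lambda> i j \<le> e * real j + C * \<theta> j" for N e n
    proof -
      have "H n * (\<Sum>l<b n. \<Sum>j = N..k n. \<Lambda> i j * U n l j)
          \<le> e * M * (real (b n) * H n) + C * sqrt (real (b n) * H n * (2 * M / real N))"
        using tail_estimate[OF \<omega>in admH \<open>1 \<le> N\<close> \<open>0 \<le> e\<close> C0 that(3), where a = 0 and b = "b n"]
        by (simp add: U_def atLeast0LessThan)
      also have "\<dots> \<le> e * M * t + C * sqrt (t * (2 * M / real N))"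
        using bH[of n] that M C0
        by (intro add_mono mult_left_mono real_sqrt_le_mono mult_right_mono) auto
      finally show ?thesis .
    qed

    \<comment> \<open>The tail bound with \<open>N = 1\<close> limits the integrals of all partial sums of
      $\sum_j \Lambda_{i,j} \omega_j$, which makes the series integrable.\<close>
    have lim1: "(\<lambda>n. H n * (\<Sum>l<b n. \<Lambda> i j * U n l j)) \<longlonglongrightarrow> (LBINT s:{0..t}. \<Lambda> i j * \<omega> j s)"
      and int1: "set_integrable lborel {0..t} (\<lambda>s. \<Lambda> i j * \<omega> j s)" if j: "1 \<le> j" for j
    proof -
      have bd: "\<bar>\<Lambda> i j * U n l j\<bar> \<le> \<Lambda> i j * M" for n l
        using kernel_nonneg[OF i j] U_nonneg[OF j] U_le[OF j] by (simp add: abs_mult mult_left_mono)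
      have cv: "(\<lambda>n. \<Lambda> i j * U n (nat \<lfloor>s / H n\<rfloor>) j) \<longlonglongrightarrow> \<Lambda> i j * \<omega> j s" if "0 \<le> s" for s
        using that j by (intro tendsto_intros U_lim)
      show "(\<lambda>n. H n * (\<Sum>l<b n. \<Lambda> i j * U n l j)) \<longlonglongrightarrow> (LBINT s:{0..t}. \<Lambda> i j * \<omega> j s)"
        unfolding b_def by (rule step_sum_tendsto_integral[where p = "\<lambda>n l. \<Lambda> i j * U n l j" and P = "\<lambda>s. \<Lambda> i j * \<omega> j s", OF H0 H bd cv t])
      show "set_integrable lborel {0..t} (\<lambda>s. \<Lambda> i j * \<omega> j s)"
        by (rule step_sum_limit_integrable[where p = "\<lambda>n l. \<Lambda> i j * U n l j" and P = "\<lambda>s. \<Lambda> i j * \<omega> j s", OF H0 H bd cv t])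
    qed
    obtain D where D: "0 \<le> D" "\<And>j. 1 \<le> j \<Longrightarrow> \<Lambda> i j \<le> D * real j + C * \<theta> j"
      using tail_growth_from_one[OF C i] by blast
    have sum1: "(\<Sum>j<N. LBINT s:{0..t}. \<Lambda> i (Suc j) * \<omega> (Suc j) s)
        \<le> D * M * t + C * sqrt (t * (2 * M / real 1))" for N
    proof (rule tendsto_upperbound)
      show "(\<lambda>n. \<Sum>j<N. H n * (\<Sum>l<b n. \<Lambda> i (Suc j) * U n l (Suc j)))
          \<longlonglongrightarrow> (\<Sum>j<N. LBINT s:{0..t}. \<Lambda> i (Suc j) * \<omega> (Suc j) s)"
        by (intro tendsto_sum lim1) simp
      show "\<forall>\<^sub>F n in sequentially. (\<Sum>j<N. H n * (\<Sum>l<b n. \<Lambda> i (Suc j) * U n l (Suc j)))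
          \<le> D * M * t + C * sqrt (t * (2 * M / real 1))"
        using k_ge[of N]
      proof eventually_elim
        case (elim n)
        have "(\<Sum>j<N. H n * (\<Sum>l<b n. \<Lambda> i (Suc j) * U n l (Suc j)))
            = H n * (\<Sum>l<b n. \<Sum>j<N. \<Lambda> i (Suc j) * U n l (Suc j))"
          by (simp add: sum_distrib_left[symmetric] sum.swap[of _ "{..<N}"])
        also have "\<dots> = H n * (\<Sum>l<b n. \<Sum>j = 1..N. \<Lambda> i j * U n l j)"
          by (simp add: sum.atLeast1_atMost_eq)
        also have "\<dots> \<le> H n * (\<Sum>l<b n. \<Sum>j = 1..k n. \<Lambda> i j * U n l j)"
          using elim H0[of n] i
          by (intro mult_left_mono sum_mono sum_mono2 mult_nonneg_nonneg kernel_nonneg U_nonneg) auto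
        also have "\<dots> \<le> D * M * t + C * sqrt (t * (2 * M / real 1))"
          using D by (intro tail) auto
        finally show ?case .
      qed
    qed simp
    have nn1: "0 \<le> \<Lambda> i (Suc j) * \<omega> (Suc j) s" if "s \<in> {0..t}" for j s
      using that i by (intro mult_nonneg_nonneg kernel_nonneg w_nonneg) auto
    have int1': "set_integrable lborel {0..t} (\<lambda>s. \<Lambda> i (Suc j) * \<omega> (Suc j) s)" for j
      by (rule int1) simp
    have "AE s in lborel. s \<in> {0..t} \<longrightarrow> summable (\<lambda>j. \<Lambda> i (Suc j) * \<omega> (Suc j) s)"
      by (rule AE_summable_of_integral_bound[OF int1' _ sum1]) (rule nn1)
    then have ae: "AE s in lborel. s \<in> {0<..<t} \<longrightarrow> summable (\<lambda>j. \<Lambda> i (Suc j) * \<omega> (Suc j) s)"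
      by eventually_elim auto
    have "set_integrable lborel {0..t} (\<lambda>s. \<Sum>j. \<Lambda> i (Suc j) * \<omega> (Suc j) s)"
      by (rule set_integrable_suminf_of_bound[OF int1' _ sum1]) (rule nn1)
    then have intS: "set_integrable lborel {0<..<t} (\<lambda>s. \<Sum>j. \<Lambda> i (Suc j) * \<omega> (Suc j) s)"
      by (rule set_integrable_subset) auto

    \<comment> \<open>The right-hand side splits into \<open>q\<close>, which involves finitely many components, and
      the terms \<open>f m\<close> of the loss series. \<open>Z m n\<close> is the defect in the integrated Euler
      scheme when the loss sum is cut after \<open>m\<close> terms, hence the integrated tail of that
      sum.\<close>
    define Q where "Q u = flux \<Lambda> i u (i - 1) - flux \<Lambda> i u i" for u
    define q where "q s = Q (\<lambda>j. \<omega> j s)" for s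
    define f where "f m s = \<Lambda> i (i + m) * \<omega> i s * \<omega> (i + m) s" for m s
    have flux_lim: "(\<lambda>n. flux \<Lambda> i (U n (nat \<lfloor>s / H n\<rfloor>)) m) \<longlonglongrightarrow> flux \<Lambda> i (\<lambda>j. \<omega> j s) m"
      if "0 \<le> s" "m \<le> i" for s m
    proof (cases "m = 0")
      case False
      with that show ?thesis
        unfolding flux_def by (auto intro!: tendsto_intros U_lim)
    qed (simp add: flux_def)
    have Qlim: "(\<lambda>n. H n * (\<Sum>l<b n. Q (U n l))) \<longlonglongrightarrow> (LBINT s:{0..t}. q s)"
      and Qint: "set_integrable lborel {0..t} q"
    proof -
      have bd: "\<bar>Q (U n l)\<bar> \<le> M * (\<Sum>j = 1..i - 1. real j * \<Lambda> (i - 1) j * M)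
          + M * (\<Sum>j = 1..i. real j * \<Lambda> i j * M)" for n l
        using abs_flux_le[OF ml, of i n l "i - 1"] abs_flux_le[OF ml, of i n l i]
        unfolding Q_def by linarith
      have cv: "(\<lambda>n. Q (U n (nat \<lfloor>s / H n\<rfloor>))) \<longlonglongrightarrow> q s" if "0 \<le> s" for s
        unfolding Q_def q_def using that by (intro tendsto_diff flux_lim) auto
      show "(\<lambda>n. H n * (\<Sum>l<b n. Q (U n l))) \<longlonglongrightarrow> (LBINT s:{0..t}. q s)"
        unfolding b_def by (rule step_sum_tendsto_integral[where p = "\<lambda>n l. Q (U n l)" and P = q, OF H0 H bd cv t])
      show "set_integrable lborel {0..t} q"
        by (rule step_sum_limit_integrable[where p = "\<lambda>n l. Q (U n l)" and P = q, OF H0 H bd cv t])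
    qed
    have flim: "(\<lambda>n. H n * (\<Sum>l<b n. \<Lambda> i (i + m) * U n l i * U n l (i + m))) \<longlonglongrightarrow> (LBINT s:{0..t}. f m s)"
      and fint: "set_integrable lborel {0..t} (f m)" for m
    proof -
      have bd: "\<bar>\<Lambda> i (i + m) * U n l i * U n l (i + m)\<bar> \<le> \<Lambda> i (i + m) * M * M" for n l
        using kernel_nonneg[of i "i + m"] i U_nonneg[of i] U_le[of i] U_nonneg[of "i + m"] U_le[of "i + m"] M
        by (auto simp: abs_mult intro!: mult_mono mult_nonneg_nonneg)
      have cv: "(\<lambda>n. \<Lambda> i (i + m) * U n (nat \<lfloor>s / H n\<rfloor>) i * U n (nat \<lfloor>s / H n\<rfloor>) (i + m)) \<longlonglongrightarrow> f m s"
        if "0 \<le> s" for s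
        unfolding f_def using that i by (intro tendsto_intros U_lim) auto
      show "(\<lambda>n. H n * (\<Sum>l<b n. \<Lambda> i (i + m) * U n l i * U n l (i + m))) \<longlonglongrightarrow> (LBINT s:{0..t}. f m s)"
        unfolding b_def by (rule step_sum_tendsto_integral[where p = "\<lambda>n l. \<Lambda> i (i + m) * U n l i * U n l (i + m)" and P = "f m", OF H0 H bd cv t])
      show "set_integrable lborel {0..t} (f m)"
        by (rule step_sum_limit_integrable[where p = "\<lambda>n l. \<Lambda> i (i + m) * U n l i * U n l (i + m)" and P = "f m", OF H0 H bd cv t])
    qed
    define Z where "Z m n = \<omega>in i + H n * (\<Sum>l<b n. Q (U n l))
        - (\<Sum>r<m. H n * (\<Sum>l<b n. \<Lambda> i (i + r) * U n l i * U n l (i + r))) - U n (b n) i" for m n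
    define X where "X = \<omega>in i + (LBINT s:{0..t}. q s) - \<omega> i t"
    have Zlim: "Z m \<longlonglongrightarrow> X - (\<Sum>r<m. LBINT s:{0..t}. f r s)" for m
    proof -
      have "Z m \<longlonglongrightarrow> \<omega>in i + (LBINT s:{0..t}. q s) - (\<Sum>r<m. LBINT s:{0..t}. f r s) - \<omega> i t"
        unfolding Z_def using U_lim[OF i t]
        by (intro tendsto_diff tendsto_add tendsto_const tendsto_sum Qlim flim) (simp add: b_def)
      then show ?thesis
        by (simp add: X_def algebra_simps)
    qed
    have Z_eq: "Z m n = H n * (\<Sum>l<b n. U n l i * (\<Sum>j = i + m..k n. \<Lambda> i j * U n l j))"
      if km: "i + m \<le> k n" for m n
    proof -
      have rhs: "trunc_rhs \<Lambda> (k n) (U n l) i = Q (U n l)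
          - (\<Sum>r<m. \<Lambda> i (i + r) * U n l i * U n l (i + r))
          - U n l i * (\<Sum>j = i + m..k n. \<Lambda> i j * U n l j)" for l
      proof -
        have "(\<Sum>j = i..k n. \<Lambda> i j * U n l j)
            = (\<Sum>j = i..<i + m. \<Lambda> i j * U n l j) + (\<Sum>j = i + m..k n. \<Lambda> i j * U n l j)"
          using km by (subst sum.union_disjoint[symmetric]) (auto intro!: sum.cong)
        also have "(\<Sum>j = i..<i + m. \<Lambda> i j * U n l j) = (\<Sum>r<m. \<Lambda> i (i + r) * U n l (i + r))"
          using sum.shift_bounds_nat_ivl[of "\<lambda>j. \<Lambda> i j * U n l j" 0 i m]
          by (simp add: atLeast0LessThan add.commute)
        finally have "loss \<Lambda> (k n) (U n l) i = (\<Sum>r<m. \<Lambda> i (i + r) * U n l i * U n l (i + r))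
            + U n l i * (\<Sum>j = i + m..k n. \<Lambda> i j * U n l j)"
          by (simp add: loss_def distrib_left sum_distrib_left mult.left_commute mult.assoc)
        moreover have "flux \<Lambda> (k n) (U n l) (i - 1) - flux \<Lambda> (k n) (U n l) i = Q (U n l)"
          using km by (simp add: Q_def flux_def)
        ultimately show ?thesis
          by (simp add: trunc_rhs_def)
      qed
      have "U n (b n) i = \<omega>in i + H n * (\<Sum>l<b n. trunc_rhs \<Lambda> (k n) (U n l) i)"
        unfolding U_def by (rule euler_eq_sum)
      also have "\<dots> = \<omega>in i + H n * (\<Sum>l<b n. Q (U n l))
          - (\<Sum>r<m. H n * (\<Sum>l<b n. \<Lambda> i (i + r) * U n l i * U n l (i + r)))
          - H n * (\<Sum>l<b n. U n l i * (\<Sum>j = i + m..k n. \<Lambda> i j * U n l j))"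
        unfolding rhs sum_subtractf right_diff_distrib sum.swap[of _ "{..<m}"] sum_distrib_left[symmetric]
        by simp
      finally show ?thesis
        unfolding Z_def by simp
    qed
    \<comment> \<open>The neglected tail is non-negative, so in the limit the partial sums stay below
      \<open>X\<close>; this bounds the loss series.\<close>
    have low: "(\<Sum>r<m. LBINT s:{0..t}. f r s) \<le> X" for m
    proof -
      have "\<forall>\<^sub>F n in sequentially. 0 \<le> Z m n"
        using k_ge[of "i + m"]
      proof eventually_elim
        case (elim n)
        then show ?case
          unfolding Z_eq[OF elim] using i H0[of n]
          by (intro mult_nonneg_nonneg sum_nonneg kernel_nonneg U_nonneg) auto
      qed
      then have "0 \<le> X - (\<Sum>r<m. LBINT s:{0..t}. f r s)"
        by (intro tendsto_lowerbound[OF Zlim]) auto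
      then show ?thesis by simp
    qed
    have f0: "0 \<le> f m s" if "s \<in> {0..t}" for m s
      unfolding f_def using that i by (intro mult_nonneg_nonneg kernel_nonneg w_nonneg) auto
    define J where "J = (LBINT s:{0..t}. \<Sum>m. f m s)"
    have Jsums: "(\<lambda>m. LBINT s:{0..t}. f m s) sums J"
      and Jint: "set_integrable lborel {0..t} (\<lambda>s. \<Sum>m. f m s)"
      unfolding J_def
      by (rule set_integral_sums_of_bound[OF fint f0 low] set_integrable_suminf_of_bound[OF fint f0 low]; assumption)+
    have JX: "J \<le> X"
      using Jsums low unfolding sums_def by (intro tendsto_upperbound[OF Jsums[unfolded sums_def]]) auto
    \<comment> \<open>Conversely the neglected tail is small: its square-root part vanishes as
      \<open>m\<close> grows with \<open>e\<close> fixed, the remainder as \<open>e\<close> tends to \<open>0\<close>.\<close>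
    have XJ: "X - J \<le> M * (e * M * t)" if e: "0 < e" for e
    proof -
      obtain N0 where N0: "\<And>j. j \<ge> N0 \<Longrightarrow> \<Lambda> i j \<le> e * real j + C * \<theta> j"
        using C e unfolding tail_growth_def eventually_sequentially by blast
      have up: "X - (\<Sum>r<m. LBINT s:{0..t}. f r s) \<le> M * (e * M * t + C * sqrt (t * (2 * M / real (i + m))))"
        if m: "N0 \<le> m" for m
      proof -
        have "\<forall>\<^sub>F n in sequentially. Z m n \<le> M * (e * M * t + C * sqrt (t * (2 * M / real (i + m))))"
          using k_ge[of "i + m"]
        proof eventually_elim
          case (elim n)
          have "Z m n \<le> H n * (\<Sum>l<b n. M * (\<Sum>j = i + m..k n. \<Lambda> i j * U n l j))"
            unfolding Z_eq[OF elim] using i H0[of n]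
            by (intro mult_left_mono sum_mono mult_right_mono U_le sum_nonneg mult_nonneg_nonneg kernel_nonneg U_nonneg) auto
          also have "\<dots> = M * (H n * (\<Sum>l<b n. \<Sum>j = i + m..k n. \<Lambda> i j * U n l j))"
            by (simp add: sum_distrib_left[symmetric] mult.left_commute)
          also have "\<dots> \<le> M * (e * M * t + C * sqrt (t * (2 * M / real (i + m))))"
            using i m e by (intro mult_left_mono[OF _ M] tail N0) auto
          finally show ?case .
        qed
        then show ?thesis
          by (intro tendsto_upperbound[OF Zlim]) auto
      qed
      have l1: "(\<lambda>m. X - (\<Sum>r<m. LBINT s:{0..t}. f r s)) \<longlonglongrightarrow> X - J"
        using Jsums unfolding sums_def by (intro tendsto_intros)
      have "(\<lambda>m. 2 * M / real (m + i)) \<longlonglongrightarrow> 0"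
        by (rule LIMSEQ_ignore_initial_segment[OF lim_const_over_n])
      then have l2: "(\<lambda>m. M * (e * M * t + C * sqrt (t * (2 * M / real (i + m)))))
          \<longlonglongrightarrow> M * (e * M * t + C * sqrt (t * 0))"
        by (intro tendsto_intros) (simp add: add.commute)
      show ?thesis
        using LIMSEQ_le[OF l1 l2] up by auto
    qed
    have "((\<lambda>e. M * (e * M * t)) \<longlongrightarrow> M * (0 * M * t)) (at_right 0)"
      by (intro tendsto_intros)
    then have "X - J \<le> M * (0 * M * t)"
      by (rule tendsto_lowerbound)
        (use XJ in \<open>auto simp: eventually_at_right_field intro!: exI[of _ 1]\<close>)
    with JX have "X = J"
      by simp
    moreover have "(LBINT s:{0..t}. sd_rhs \<Lambda> (\<lambda>k. \<omega> k s) i) = (LBINT s:{0..t}. q s) - J"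
    proof -
      have "sd_rhs \<Lambda> (\<lambda>k. \<omega> k s) i = q s - (\<Sum>m. f m s)" for s
        by (simp add: sd_rhs_def q_def Q_def f_def flux_def)
      then show ?thesis
        unfolding J_def using set_integral_diff(2)[OF Qint Jint] by simp
    qed
    ultimately have "\<omega> i t = \<omega>in i + (LBINT s:{0..t}. sd_rhs \<Lambda> (\<lambda>k. \<omega> k s) i)"
      by (simp add: X_def)
    with ae intS show ?thesis
      by blast
  qed
  have "{t::real. 0 \<le> t \<and> ereal t < \<infinity>} = {0..}"
    by auto
  then have "sd_solution \<Lambda> \<omega>in \<infinity> \<omega>"
    unfolding sd_solution_def
    by (intro conjI allI impI sol[THEN conjunct1] sol[THEN conjunct2, THEN conjunct1]
        sol[THEN conjunct2, THEN conjunct2])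
      (auto simp: cont w_nonneg)
  with mlw show ?thesis
    by blast
qed

end

section \<open>Existence for the two classes of kernels\<close>

lemma mass_le_of_Y_plus:
  assumes "y \<in> Y_plus 1"
  shows "mass_le (Y_norm 1 y) y"
proof -
  have s: "summable (\<lambda>i. real (Suc i) * y (Suc i))"
    and n: "Y_norm 1 y = (\<Sum>i. real (Suc i) * y (Suc i))"
    using assms by (auto simp: Y_plus_def Y_def Y_norm_def)
  have "(\<Sum>i = 1..N. real i * y i) \<le> Y_norm 1 y" for N
    using sum_le_suminf[OF s, of "{..<N}"] assms
    by (simp add: n sum.atLeast1_atMost_eq Y_plus_def)
  then show ?thesis
    using assms by (auto simp: mass_le_def Y_plus_def)
qed

lemma Y_plus_of_mass_le:
  assumes "mass_le M y"
  shows "y \<in> Y_plus 1" "Y_norm 1 y \<le> M"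
proof -
  have b: "(\<Sum>i<N. real (Suc i) * y (Suc i)) \<le> M" for N
    using mass_le_sum[OF assms, of N] by (simp add: sum.atLeast1_atMost_eq)
  have p: "0 \<le> real (Suc i) * y (Suc i)" for i
    using mass_le_nonneg[OF assms] by simp
  have s: "summable (\<lambda>i. real (Suc i) * y (Suc i))"
    by (rule summableI_nonneg_bounded[OF p b])
  then show "y \<in> Y_plus 1"
    using mass_le_nonneg[OF assms] by (simp add: Y_plus_def Y_def)
  show "Y_norm 1 y \<le> M"
    using suminf_le_const[OF s b] mass_le_nonneg[OF assms] by (simp add: Y_norm_def)
qed

theorem theorem2p1:
  fixes \<Lambda> \<kappa> :: "nat \<Rightarrow> nat \<Rightarrow> real" and \<theta> \<omega>in :: "nat \<Rightarrow> real"
  assumes "coag_kernel \<Lambda>"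
    and "\<And>i. i \<ge> 1 \<Longrightarrow> 0 \<le> \<theta> i"
    and "\<And>i j. i \<ge> 1 \<Longrightarrow> j \<ge> 1 \<Longrightarrow> 0 \<le> \<kappa> i j"
    and "\<And>i j. i \<ge> 1 \<Longrightarrow> j \<ge> 1 \<Longrightarrow> \<Lambda> i j = \<theta> i * \<theta> j + \<kappa> i j"
    and "((\<lambda>i. \<theta> i / real i) \<longlonglongrightarrow> 0 \<and> (\<forall>i\<ge>1. (\<lambda>j. \<kappa> i j / real j) \<longlonglongrightarrow> 0)) \<or>
         ((\<exists>B>0. (INF i\<in>{1..}. \<theta> i / real i) = B) \<and>
          (\<exists>A\<ge>0. \<forall>i\<ge>1. \<forall>j\<ge>1. \<kappa> i j \<le> A * \<theta> i * \<theta> j))"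
    and "\<omega>in \<in> Y_plus 1"
  shows "\<exists>\<omega>. sd_solution \<Lambda> \<omega>in \<infinity> \<omega> \<and>
    (\<forall>t\<ge>0. (\<lambda>i. \<omega> i t) \<in> Y_plus 1 \<and> Y_norm 1 (\<lambda>i. \<omega> i t) \<le> Y_norm 1 \<omega>in)"
proof -
  interpret sd_kernel \<Lambda> \<theta>
    using assms(1-4) by unfold_locales (auto simp: coag_kernel_def)
  have "\<exists>C. tail_growth i C" if i: "1 \<le> i" for i
    using assms(5)
  proof (elim disjE conjE exE)
    assume "\<forall>i\<ge>1. (\<lambda>j. \<kappa> i j / real j) \<longlonglongrightarrow> 0"
    with i have lim: "(\<lambda>j. \<kappa> i j / real j) \<longlonglongrightarrow> 0"
      by simp
    have "\<forall>\<^sub>F j in sequentially. \<Lambda> i j \<le> e * real j + \<theta> i * \<theta> j" if "0 < e" for e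
      using order_tendstoD(2)[OF lim that] eventually_ge_at_top[of 1]
    proof eventually_elim
      case (elim j)
      then show ?case
        using assms(4)[OF i, of j] by (simp add: field_simps)
    qed
    then have "tail_growth i (\<theta> i)"
      using assms(2)[OF i] by (simp add: tail_growth_def)
    then show ?thesis ..
  next
    fix A assume A: "0 \<le> A" "\<forall>i\<ge>1. \<forall>j\<ge>1. \<kappa> i j \<le> A * \<theta> i * \<theta> j"
    have "\<forall>\<^sub>F j in sequentially. \<Lambda> i j \<le> e * real j + ((1 + A) * \<theta> i) * \<theta> j" if "0 < e" for e
      using eventually_ge_at_top[of 1]
    proof eventually_elim
      case (elim j)
      then have "\<Lambda> i j \<le> ((1 + A) * \<theta> i) * \<theta> j"
        using assms(4)[OF i, of j] A(2) i by (simp add: algebra_simps)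
      moreover have "0 \<le> e * real j"
        using that by simp
      ultimately show ?case by linarith
    qed
    then have "tail_growth i ((1 + A) * \<theta> i)"
      using assms(2)[OF i] A(1) by (simp add: tail_growth_def)
    then show ?thesis ..
  qed
  then obtain \<omega> where "sd_solution \<Lambda> \<omega>in \<infinity> \<omega>"
    and "\<And>t. 0 \<le> t \<Longrightarrow> mass_le (Y_norm 1 \<omega>in) (\<lambda>i. \<omega> i t)"
    using sd_solution_exists[OF mass_le_of_Y_plus[OF assms(6)]] by metis
  then show ?thesis
    using Y_plus_of_mass_le by blast
qed

end
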